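(* Suppose that: (i) all second partial derivatives of $J:\mathbb{R}^n\times\mathbb{R}^d\to\mathbb{R}$ exist and are Lipschitz continuous, and there are scalars $0<m\le L$ such that for every $\theta\in\Theta$ and all $\xi,\xi'\in\mathbb{R}^n$ $$J(\xi,\theta)+\nabla_\xi J(\xi,\theta)^\top(\xi'-\xi)+\tfrac{m}{2}\|\xi'-\xi\|_2^2\le J(\xi',\theta)\le J(\xi,\theta)+\nabla_\xi J(\xi,\theta)^\top(\xi'-\xi)+\tfrac{L}{2}\|\xi'-\xi\|_2^2;$$ (ii) $S_{\mathcal C}$ is $\mathbb{R}^n$ or an affine subspace of $\mathbb{R}^n$ (in particular convex and closed); (iii) $\Theta\subset\mathbb{R}^d$ is convex and compact; (iv) $S_\xi^0\subseteq S_{\mathcal C}$ is bounded. Let $c_\alpha,C_\alpha\in(0,\tfrac2L)$ with $c_\alpha\le C_\alpha$, let $N\ge1$, $\xi_0\in S_\xi^0$, $\hat\theta_0\in\Theta$, and let $(\hat\zeta_0,\dots,\hat\zeta_N)$, $(\hat\alpha_0,\dots,\hat\alpha_N)$ be a nominal trajectory, i.e. $\hat\zeta_0=(\xi_0,\hat\theta_0)$ and $\hat\zeta_{k+1}=f(\hat\zeta_k,\hat\alpha_k)$ for $k=0,\dots,N-1$. Let $\Phi$ be a system response satisfying the affine constraints (A1)–(A3) of the context (for the Jacobians along this nominal trajectory), and let $\boldsymbol{\mu}=\mathrm{diag}\{\mu_1,\dots,\mu_{n+d}\}$ be as in the context. Suppose there exist real numbers $\tau_0,\dots,\tau_N$ such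 that for all $k\in\{0,\dots,N\}$: $$a_p^\top(\hat\zeta_k,\hat\alpha_k)+b_p+\left\|a_p^\top\begin{bmatrix}(\Phi_{\zeta d})_{k,0}\\(\Phi_{\alpha d})_{k,0}\end{bmatrix}\right\|_1\mathrm{diam}(\Theta)+\sum_{j=1}^k\tau_{j-1}^2\left\|a_p^\top\begin{bmatrix}(\Phi_{\zeta d})_{k,j}\\(\Phi_{\alpha d})_{k,j}\end{bmatrix}\boldsymbol{\mu}\right\|_1\le0\quad\text{for } p\in\{1,2\},$$ $$\left\|\begin{bmatrix}(\Phi_{\zeta d})_{k,0}\\(\Phi_{\alpha d})_{k,0}\end{bmatrix}\right\|_\infty\mathrm{diam}(\Theta)+\sum_{j=1}^k\tau_{j-1}^2\left\|\begin{bmatrix}(\Phi_{\zeta d})_{k,j}\\(\Phi_{\alpha d})_{k,j}\end{bmatrix}\boldsymbol{\mu}\right\|_\infty\le\tau_k .$$ Then for every $\theta\in\Theta$, the closed-loop trajectory with true parameter $\theta$, namely $\zeta_0=(\xi_0,\theta)$, $\zeta_{k+1}=f(\zeta_k,\alpha_k)$ for $k=0,\dots,N-1$, with $\alpha_k=\hat\alpha_k+\sum_{j=0}^kK_{k,j}(\xi_j-\hat\xi_j)$ for $k=0,\dots,N$ (where $K_{k,j}$ are the feedback gains induced by $\Phi$), satisfies $$\|(\zeta_k-\hat\zeta_k,\;\alpha_k-\hat\alpha_k)\|_\infty\le\tau_k\quad\text{and}\quad\alpha_k\in[c_\alpha,C_\alpha]\qquad\text{for each }k\in\{0,\dots,N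\}.$$
   Context: Dynamics. $\mathrm{proj}_{S_{\mathcal C}}$ is Euclidean projection onto $S_{\mathcal C}$; the projected gradient descent (PGD) map is $f_{\mathrm{PGD}}(\xi,\theta,\alpha):=\mathrm{proj}_{S_{\mathcal C}}(\xi-\alpha\nabla_\xi J(\xi,\theta))$; and $f(\xi,\theta,\alpha):=(f_{\mathrm{PGD}}(\xi,\theta,\alpha),\theta)\in\mathbb{R}^{n+d}$, with components $f_i$. Write $\zeta=(\xi,\theta)$, $\zeta_k=(\xi_k,\theta_k)$, $\hat\zeta_k=(\hat\xi_k,\hat\theta_k)$, and $f(\zeta,\alpha)$. Reachable sets and curvature constants. $\phi_k(\xi_0,\theta,\alpha_{0:k-1})$ is the $k$-th PGD iterate from $\xi_0$ with parameter $\theta$ and steplengths $\alpha_0,\dots,\alpha_{k-1}$; $S_{\xi,k}(\xi_0,\alpha_{0:k-1}):=\{\phi_k(\xi_0,\theta,\alpha_{0:k-1}):\theta\in\Theta\}$; $S_{\xi,\mathrm{CH}}$ is the convex hull of the union of these sets over all $k\ge0$, $\xi_0\in S_\xi^0$, $\alpha_{0:k-1}\in[c_\alpha,C_\alpha]^k$. The constants $\mu_1,\dots,\mu_{n+d}>0$ are such that for each $i$ and all $(\zeta,\alpha),(\zeta',\alpha')\in S_{\xi,\mathrm{CH}}\times\Theta\times[c_\alpha,C_\alpha]$, $\|\nabla f_i(\zeta,\alpha)-\nabla f_i(\zeta',\alpha')\|_1\le\mu_i\|(\zeta,\alpha)-(\zeta',\alpha')\|_\infty$ (gradients with respect to $(\zeta,\alpha)$).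 Steplength constraints. $a_1:=(0_{n+d},1)$, $a_2:=(0_{n+d},-1)\in\mathbb{R}^{n+d+1}$, $b_1:=-C_\alpha$, $b_2:=c_\alpha$, so that $a_p^\top(\zeta,\alpha)+b_p\le0$ for $p=1,2$ iff $c_\alpha\le\alpha\le C_\alpha$. System response. Let $A_k:=\frac{\partial f}{\partial\zeta}(\hat\zeta_k,\hat\alpha_k)\in\mathbb{R}^{(n+d)\times(n+d)}$, $B_k:=\frac{\partial f}{\partial\alpha}(\hat\zeta_k,\hat\alpha_k)\in\mathbb{R}^{(n+d)\times1}$, and $C:=[\,I_n\ \ O_{n\times d}\,]\in\mathbb{R}^{n\times(n+d)}$. Let $\mathcal{A}:=\mathrm{blkdiag}\{A_0,\dots,A_{N-1},O_{n+d}\}$, $\mathcal{B}:=\mathrm{blkdiag}\{B_0,\dots,B_{N-1},0_{n+d}\}$, $\mathcal{C}:=\mathrm{blkdiag}\{C,\dots,C\}$ ($N+1$ blocks), and let $\mathcal{Z}$ be the block downshift matrix of size $(n+d)(N+1)$: identity blocks of size $n+d$ on the first block subdiagonal, zeros elsewhere. A system response is a matrix $$\Phi=\begin{bmatrix}\Phi_{\zeta d}&\Phi_{\zeta v}\\\Phi_{\alpha d}&\Phi_{\alpha v}\end{bmatrix}\in\mathbb{R}^{(n+d+1)(N+1)\times(2n+d)(N+1)},$$ where $\Phi_{\zeta d},\Phi_{\zeta v},\Phi_{\alpha d},\Phi_{\alpha v}$ have $(N+1)\times(N+1)$ blocks, indexed by $k,j\in\{0,\dots,N\}$, of sizes $(n+d)\times(n+d)$,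 $(n+d)\times n$, $1\times(n+d)$, $1\times n$ respectively; $(\cdot)_{k,j}$ denotes the $(k,j)$ block. The affine constraints are: (A1) $[\,I-\mathcal{Z}\mathcal{A}\ \ -\mathcal{Z}\mathcal{B}\,]\,\Phi=[\,I\ \ O\,]$; (A2) $\Phi\begin{bmatrix}I-\mathcal{Z}\mathcal{A}\\-\mathcal{C}\end{bmatrix}=\begin{bmatrix}I\\O\end{bmatrix}$; (A3) $\Phi_{\zeta d},\Phi_{\zeta v},\Phi_{\alpha d},\Phi_{\alpha v}$ are lower block-triangular. The induced feedback gain matrix is $\mathcal{K}:=\Phi_{\alpha v}-\Phi_{\alpha d}\Phi_{\zeta d}^{-1}\Phi_{\zeta v}$, which is lower block-triangular with blocks $K_{k,j}\in\mathbb{R}^{1\times n}$, $0\le j\le k\le N$; it acts on output errors $\xi_j-\hat\xi_j$. Norms. For vectors, including row vectors, $\|\cdot\|_1$ is the sum of absolute values of entries and $\|\cdot\|_\infty$ the maximum; for matrices with several rows, $\|\cdot\|_\infty$ is the induced $\infty$-norm (maximum absolute row sum). $\mathrm{diam}(\Theta):=\sup_{\theta,\theta'\in\Theta}\|\theta-\theta'\|_2$. *)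

theory Defs
  imports "HOL-Analysis.Analysis"
begin

text \<open>Concatenation along the first index. With \<^typ>\<open>'a\<close> a scalar type this is the stacked
  vector $(x, y)$; with \<^typ>\<open>'a\<close> a type of row vectors it stacks one matrix on top of another.\<close>

definition vstack :: "'a^'m \<Rightarrow> 'a^'k \<Rightarrow> 'a^('m + 'k)" where
  "vstack x y = (\<chi> i. case i of Inl a \<Rightarrow> x $ a | Inr b \<Rightarrow> y $ b)"

definition vtop :: "'a^('m + 'k::finite) \<Rightarrow> 'a^'m" where
  "vtop z = (\<chi> i. z $ Inl i)"

definition vbot :: "'a^('m::finite + 'k) \<Rightarrow> 'a^'k" where
  "vbot z = (\<chi> i. z $ Inr i)"

text \<open>The maximum norm of a vector is the library's \<^const>\<open>infnorm\<close>.\<close>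

definition l1norm :: "real^'n \<Rightarrow> real" where
  "l1norm x = (\<Sum>i\<in>UNIV. \<bar>x $ i\<bar>)"

definition mat_infnorm :: "real^'c^'r \<Rightarrow> real" where
  "mat_infnorm A = (MAX i. l1norm (row i A))"

definition diag_mat :: "real^'n \<Rightarrow> real^'n^'n" where
  "diag_mat v = (\<chi> i j. if i = j then v $ i else 0)"

definition partially_differentiable :: "'n \<Rightarrow> (real^'n \<Rightarrow> real) \<Rightarrow> real^'n \<Rightarrow> bool" where
  "partially_differentiable i g x \<longleftrightarrow>
     (\<lambda>t. g (x + t *\<^sub>R axis i 1)) field_differentiable (at 0)"

definition partial :: "'n \<Rightarrow> (real^'n \<Rightarrow> real) \<Rightarrow> real^'n \<Rightarrow> real" where
  "partial i g x = deriv (\<lambda>t. g (x + t *\<^sub>R axis i 1)) 0"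

definition grad :: "(real^'n \<Rightarrow> real) \<Rightarrow> real^'n \<Rightarrow> real^'n" where
  "grad g x = (\<chi> i. partial i g x)"

definition lipschitz_second_partials :: "(real^'n \<Rightarrow> real) \<Rightarrow> bool" where
  "lipschitz_second_partials g \<longleftrightarrow>
     (\<forall>i x. partially_differentiable i g x) \<and>
     (\<forall>i j x. partially_differentiable j (partial i g) x) \<and>
     (\<forall>i j. \<exists>M. M-lipschitz_on UNIV (partial j (partial i g)))"

definition pgd_step ::
  "(real^'n) set \<Rightarrow> (real^'n \<Rightarrow> real^'d \<Rightarrow> real) \<Rightarrow> real^'n \<Rightarrow> real^'d \<Rightarrow> real \<Rightarrow> real^'n" where
  "pgd_step SC J \<xi> \<theta> \<alpha> = closest_point SC (\<xi> - \<alpha> *\<^sub>R grad (\<lambda>x. J x \<theta>) \<xi>)"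

definition pgd_dyn ::
  "(real^'n) set \<Rightarrow> (real^'n \<Rightarrow> real^'d \<Rightarrow> real) \<Rightarrow> real^('n + 'd) \<Rightarrow> real \<Rightarrow> real^('n + 'd)" where
  "pgd_dyn SC J \<zeta> \<alpha> = vstack (pgd_step SC J (vtop \<zeta>) (vbot \<zeta>) \<alpha>) (vbot \<zeta>)"

primrec pgd_iter ::
  "(real^'n) set \<Rightarrow> (real^'n \<Rightarrow> real^'d \<Rightarrow> real) \<Rightarrow> real^'n \<Rightarrow> real^'d \<Rightarrow> (nat \<Rightarrow> real)
     \<Rightarrow> nat \<Rightarrow> real^'n" where
  "pgd_iter SC J \<xi>0 \<theta> \<alpha> 0 = \<xi>0"
| "pgd_iter SC J \<xi>0 \<theta> \<alpha> (Suc k) = pgd_step SC J (pgd_iter SC J \<xi>0 \<theta> \<alpha> k) \<theta> (\<alpha> k)"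

definition reach_set ::
  "(real^'n) set \<Rightarrow> (real^'n \<Rightarrow> real^'d \<Rightarrow> real) \<Rightarrow> (real^'d) set \<Rightarrow> nat \<Rightarrow> real^'n
     \<Rightarrow> (nat \<Rightarrow> real) \<Rightarrow> (real^'n) set" where
  "reach_set SC J \<Theta> k \<xi>0 \<alpha> = {pgd_iter SC J \<xi>0 \<theta> \<alpha> k | \<theta>. \<theta> \<in> \<Theta>}"

text \<open>A steplength tuple of length $k$ is represented by a sequence of which only the first $k$
  entries matter.\<close>

definition reach_hull ::
  "(real^'n) set \<Rightarrow> (real^'n \<Rightarrow> real^'d \<Rightarrow> real) \<Rightarrow> (real^'d) set \<Rightarrow> (real^'n) set
     \<Rightarrow> real \<Rightarrow> real \<Rightarrow> (real^'n) set" where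
  "reach_hull SC J \<Theta> S0 c\<alpha> C\<alpha> =
     convex hull (\<Union>k. \<Union>\<xi>0\<in>S0. \<Union>\<alpha>\<in>{\<alpha>. \<forall>i<k. \<alpha> i \<in> {c\<alpha>..C\<alpha>}}. reach_set SC J \<Theta> k \<xi>0 \<alpha>)"

definition curvature_constants ::
  "(real^'n) set \<Rightarrow> (real^'n \<Rightarrow> real^'d \<Rightarrow> real) \<Rightarrow> (real^'d) set \<Rightarrow> (real^'n) set
     \<Rightarrow> real \<Rightarrow> real \<Rightarrow> real^('n + 'd) \<Rightarrow> bool" where
  "curvature_constants SC J \<Theta> S0 c\<alpha> C\<alpha> \<mu> \<longleftrightarrow>
     (let D = {vstack (vstack \<xi> \<theta>) (vec \<alpha>) :: real^(('n + 'd) + 1) | \<xi> \<theta> \<alpha>.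
                 \<xi> \<in> reach_hull SC J \<Theta> S0 c\<alpha> C\<alpha> \<and> \<theta> \<in> \<Theta> \<and> \<alpha> \<in> {c\<alpha>..C\<alpha>}};
          F = (\<lambda>i w. pgd_dyn SC J (vtop w) (vbot w $ 1) $ i)
      in \<forall>i. 0 < \<mu> $ i \<and>
           (\<forall>w\<in>D. \<forall>w'\<in>D. l1norm (grad (F i) w - grad (F i) w') \<le> \<mu> $ i * infnorm (w - w')))"

text \<open>A matrix with $(N+1) \times (N+1)$ blocks, all of the same size, is represented by its blocks
  as a function of the block indices; only the blocks with indices in $\{0,\dots,N\}$ matter.\<close>

type_synonym ('r, 'c) blkmat = "nat \<Rightarrow> nat \<Rightarrow> real^'c^'r"

definition blk_eq :: "nat \<Rightarrow> ('r::finite, 'c::finite) blkmat \<Rightarrow> ('r, 'c) blkmat \<Rightarrow> bool" where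
  "blk_eq N X Y \<longleftrightarrow> (\<forall>k\<le>N. \<forall>j\<le>N. X k j = Y k j)"

definition blk_zero :: "('r::finite, 'c::finite) blkmat" where
  "blk_zero = (\<lambda>k j. 0)"

definition blk_diag :: "(nat \<Rightarrow> real^'c^'r) \<Rightarrow> ('r::finite, 'c::finite) blkmat" where
  "blk_diag M = (\<lambda>k j. if k = j then M k else 0)"

definition blk_id :: "('r::finite, 'r) blkmat" where
  "blk_id = blk_diag (\<lambda>_. mat 1)"

definition blk_shift :: "('r::finite, 'r) blkmat" where
  "blk_shift = (\<lambda>k j. if k = Suc j then mat 1 else 0)"

definition blk_minus ::
  "('r::finite, 'c::finite) blkmat \<Rightarrow> ('r, 'c) blkmat \<Rightarrow> ('r, 'c) blkmat" where
  "blk_minus X Y = (\<lambda>k j. X k j - Y k j)"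

definition blk_mult ::
  "nat \<Rightarrow> ('r::finite, 'm::finite) blkmat \<Rightarrow> ('m, 'c::finite) blkmat \<Rightarrow> ('r, 'c) blkmat" where
  "blk_mult N X Y = (\<lambda>k j. \<Sum>l\<le>N. X k l ** Y l j)"

text \<open>Analogue of \<^const>\<open>matrix_inv\<close>.\<close>

definition blk_inv :: "nat \<Rightarrow> ('r::finite, 'r) blkmat \<Rightarrow> ('r, 'r) blkmat" where
  "blk_inv N X = (SOME Y. blk_eq N (blk_mult N X Y) blk_id \<and> blk_eq N (blk_mult N Y X) blk_id)"

definition blk_lower_triangular :: "nat \<Rightarrow> ('r::finite, 'c::finite) blkmat \<Rightarrow> bool" where
  "blk_lower_triangular N X \<longleftrightarrow> (\<forall>k\<le>N. \<forall>j\<le>N. k < j \<longrightarrow> X k j = 0)"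

definition output_mat :: "real^('n + 'd::finite)^'n" where
  "output_mat = (\<chi> i j. if j = Inl i then 1 else 0)"

text \<open>Here $\Phi$ has the rows $[\Phi_{\zeta d}, \Phi_{\zeta v}]$ and
  $[\Phi_{\alpha d}, \Phi_{\alpha v}]$. The first two conjuncts are
  $[I - \mathcal{Z}\mathcal{A}, \, -\mathcal{Z}\mathcal{B}] \, \Phi = [I, \, O]$, and the next two are
  $\Phi$ times the column of blocks $I - \mathcal{Z}\mathcal{A}$, $-\mathcal{C}$ being the column of
  blocks $I$, $O$; both are written out along the $2 \times 2$ partition of $\Phi$.
  The last diagonal blocks of $\mathcal{A}$ and $\mathcal{B}$ are zero.\<close>

definition system_response ::
  "nat \<Rightarrow> (nat \<Rightarrow> real^('n + 'd)^('n + 'd)) \<Rightarrow> (nat \<Rightarrow> real^1^('n + 'd))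
     \<Rightarrow> ('n::finite + 'd::finite, 'n + 'd) blkmat \<Rightarrow> ('n + 'd, 'n) blkmat
     \<Rightarrow> (1, 'n + 'd) blkmat \<Rightarrow> (1, 'n) blkmat \<Rightarrow> bool" where
  "system_response N A B \<Phi>\<zeta>d \<Phi>\<zeta>v \<Phi>\<alpha>d \<Phi>\<alpha>v \<longleftrightarrow>
     (let \<A> = blk_diag (\<lambda>k. if k < N then A k else 0);
          \<B> = blk_diag (\<lambda>k. if k < N then B k else 0);
          \<C> = blk_diag (\<lambda>_. output_mat :: real^('n + 'd)^'n);
          IZA = blk_minus blk_id (blk_mult N blk_shift \<A>);
          ZB = blk_mult N blk_shift \<B>
      in blk_eq N (blk_minus (blk_mult N IZA \<Phi>\<zeta>d) (blk_mult N ZB \<Phi>\<alpha>d)) blk_id \<and>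
         blk_eq N (blk_minus (blk_mult N IZA \<Phi>\<zeta>v) (blk_mult N ZB \<Phi>\<alpha>v)) blk_zero \<and>
         blk_eq N (blk_minus (blk_mult N \<Phi>\<zeta>d IZA) (blk_mult N \<Phi>\<zeta>v \<C>)) blk_id \<and>
         blk_eq N (blk_minus (blk_mult N \<Phi>\<alpha>d IZA) (blk_mult N \<Phi>\<alpha>v \<C>)) blk_zero \<and>
         blk_lower_triangular N \<Phi>\<zeta>d \<and> blk_lower_triangular N \<Phi>\<zeta>v \<and>
         blk_lower_triangular N \<Phi>\<alpha>d \<and> blk_lower_triangular N \<Phi>\<alpha>v)"

definition feedback_gain ::
  "nat \<Rightarrow> ('z::finite, 'z) blkmat \<Rightarrow> ('z, 'n::finite) blkmat \<Rightarrow> (1, 'z) blkmat \<Rightarrow> (1, 'n) blkmat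
     \<Rightarrow> (1, 'n) blkmat" where
  "feedback_gain N \<Phi>\<zeta>d \<Phi>\<zeta>v \<Phi>\<alpha>d \<Phi>\<alpha>v =
     blk_minus \<Phi>\<alpha>v (blk_mult N (blk_mult N \<Phi>\<alpha>d (blk_inv N \<Phi>\<zeta>d)) \<Phi>\<zeta>v)"

text \<open>The constraints $a_p^\top (\zeta, \alpha) + b_p \le 0$, $p \in \{1, 2\}$, encode
  $c_\alpha \le \alpha \le C_\alpha$.\<close>

definition step_a :: "nat \<Rightarrow> real^('z::finite + 1)" where
  "step_a p = vstack 0 (vec (if p = 1 then 1 else - 1))"

definition step_b :: "real \<Rightarrow> real \<Rightarrow> nat \<Rightarrow> real" where
  "step_b c\<alpha> C\<alpha> p = (if p = 1 then - C\<alpha> else c\<alpha>)"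

end

theory Submission
  imports Defs
begin

text \<open>Write $x_k = \zeta_k - \hat\zeta_k$ and $u_k = \alpha_k - \hat\alpha_k$. The linearization error
  $w_k = x_{k+1} - A_k x_k - B_k u_k$ acts as a disturbance on the linear time-varying error system, so
  with $d = (x_0, w_0, \dots, w_{N-1})$ the system response gives $x = \Phi_{\zeta d} d$ and
  $u = \Phi_{\alpha d} d$ exactly. By causality $(x_k, u_k)$ involves only $w_j$ with $j < k$. As long as
  the steplengths up to time $j$ are admissible, both trajectories stay in the convex set on
  which the gradients of $f$ are Lipschitz, and the mean value theorem gives
  $|w_{j,i}| \le \mu_i \, \|(x_j, u_j)\|_\infty^2 \le \mu_i \tau_j^2$. Hence the two hypotheses on
  $\tau$ close a strong induction on $k$.\<close>

subsection \<open>Stacked vectors\<close>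

lemma vstack_nth [simp]: "vstack x y $ Inl a = x $ a" "vstack x y $ Inr b = y $ b"
  by (simp_all add: vstack_def)

lemma vtop_nth [simp]: "vtop z $ i = z $ Inl i" and vbot_nth [simp]: "vbot z $ j = z $ Inr j"
  by (simp_all add: vtop_def vbot_def)

text \<open>Extensionality split along the two summands of the index type. Most identities between
  stacked vectors reduce to it.\<close>

lemma vec_sum_eq_iff:
  fixes x y :: "'a^('m::finite + 'k::finite)"
  shows "x = y \<longleftrightarrow> (\<forall>i. x $ Inl i = y $ Inl i) \<and> (\<forall>j. x $ Inr j = y $ Inr j)"
  unfolding vec_eq_iff by (metis sum.exhaust)

lemma vtop_vstack [simp]: "vtop (vstack x y) = x" and vbot_vstack [simp]: "vbot (vstack x y) = y"
  by (simp_all add: vec_eq_iff)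

lemma vstack_vtop_vbot [simp]: "vstack (vtop z) (vbot z) = z"
  by (simp add: vec_sum_eq_iff)

lemma vtop_add: "vtop (x + y) = vtop x + vtop y" and vbot_add: "vbot (x + y) = vbot x + vbot y"
  and vtop_diff: "vtop (x - y) = vtop x - vtop y"
  by (simp_all add: vec_eq_iff)

lemma vtop_scaleR: "vtop (c *\<^sub>R x) = c *\<^sub>R vtop x" and vbot_scaleR: "vbot (c *\<^sub>R x) = c *\<^sub>R vbot x"
  by (simp_all add: vec_eq_iff)

lemma vstack_add: "vstack (x + x') (y + y') = vstack x y + vstack x' y'"
  and vstack_diff: "vstack (x - x') (y - y') = vstack x y - vstack x' y'"
  by (simp_all add: vec_sum_eq_iff)

lemma vec_diff: "(vec (x - y) :: real^'n) = vec x - vec y"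
  by (simp add: vec_eq_iff)

lemma diag_mat_mult: "diag_mat v *v x = (\<chi> i. v $ i * x $ i)"
  by (simp add: diag_mat_def matrix_vector_mult_def vec_eq_iff if_distrib if_distribR cong: if_cong)

lemma vstack_mult: "vstack A B *v x = vstack (A *v x) (B *v x)"
  by (simp add: matrix_vector_mult_def vec_sum_eq_iff)

lemma vstack_sum: "(\<Sum>i\<in>I. vstack (f i) (g i)) = vstack (\<Sum>i\<in>I. f i) (\<Sum>i\<in>I. g i)"
  by (simp add: vec_sum_eq_iff)

subsection \<open>Functions with Lipschitz partial derivatives\<close>

lemma has_derivative_imp_partial:
  assumes "(g has_derivative g') (at (x :: real^'n))"
  shows "partial i g x = g' (axis i 1)"
proof -
  have "((\<lambda>t::real. x + t *\<^sub>R axis i 1) has_derivative (\<lambda>t. t *\<^sub>R axis i 1)) (at 0)"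
    by (auto intro!: derivative_eq_intros)
  then have "((\<lambda>t. g (x + t *\<^sub>R axis i 1)) has_derivative (\<lambda>t. g' (t *\<^sub>R axis i 1))) (at 0)"
    by (rule has_derivative_compose) (use assms in simp)
  then have "((\<lambda>t. g (x + t *\<^sub>R axis i 1)) has_field_derivative g' (axis i 1)) (at 0)"
    by (simp add: has_field_derivative_def linear_cmul[OF has_derivative_linear[OF assms]]
        mult.commute[of _ "g' _"])
  then show ?thesis
    unfolding partial_def by (rule DERIV_imp_deriv)
qed

text \<open>By linearity a derivative is determined by its values on the coordinate axes, and those
  are the partial derivatives. This links \<open>grad\<close>, which is built from one-dimensional
  derivatives, to the Frechet derivative.\<close>

lemma has_derivative_imp_grad:
  assumes "(g has_derivative g') (at (x :: real^'n))"
  shows "g' h = grad g x \<bullet> h"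
proof -
  have "g' h = g' (\<Sum>i\<in>UNIV. (h $ i) *\<^sub>R axis i 1)"
    using basis_expansion[of h] by (simp add: scalar_mult_eq_scaleR)
  also have "\<dots> = (\<Sum>i\<in>UNIV. h $ i * partial i g x)"
    using has_derivative_linear[OF assms]
    by (simp add: linear_sum linear_cmul has_derivative_imp_partial[OF assms])
  also have "\<dots> = grad g x \<bullet> h"
    by (simp add: grad_def inner_vec_def mult.commute)
  finally show ?thesis .
qed

text \<open>\<open>partial\<close> differentiates at parameter 0 only; moving the base point along
  the axis gives the derivative at every parameter \<open>t\<close>.\<close>

lemma partial_has_derivative:
  assumes "\<And>x. partially_differentiable i g x"
  shows "((\<lambda>t. g (x + t *\<^sub>R axis i 1)) has_derivative (\<lambda>h. partial i g (x + t *\<^sub>R axis i 1) * h)) (at t)"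
proof -
  let ?y = "x + t *\<^sub>R axis i 1"
  have "((\<lambda>s. g (?y + s *\<^sub>R axis i 1)) has_field_derivative partial i g ?y) (at 0)"
    using assms[of ?y] unfolding partially_differentiable_def partial_def
    by (simp add: DERIV_deriv_iff_field_differentiable)
  then have "((\<lambda>s. g (x + (t + s) *\<^sub>R axis i 1)) has_field_derivative partial i g ?y) (at 0)"
    by (simp add: algebra_simps)
  then have "((\<lambda>s. g (x + s *\<^sub>R axis i 1)) has_field_derivative partial i g ?y) (at t)"
    using DERIV_shift[of "\<lambda>s. g (x + s *\<^sub>R axis i 1)" "partial i g ?y" 0 t] by (simp add: add.commute)
  then show ?thesis
    by (simp add: has_field_derivative_def)
qed

text \<open>Mean value theorem in one coordinate. The slope \<open>p\<close> is left free because it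
  will be the partial derivative at another point than the \<open>x\<close> from which the step is
  taken.\<close>

lemma increment_along_axis:
  fixes g :: "real^'n \<Rightarrow> real"
  assumes pd: "\<And>x. partially_differentiable i g x"
    and lip: "M-lipschitz_on UNIV (partial i g)"
  shows "\<bar>g (x + s *\<^sub>R axis i 1) - g x - s * p\<bar> \<le> \<bar>s\<bar> * (\<bar>partial i g x - p\<bar> + M * \<bar>s\<bar>)"
proof -
  let ?f = "\<lambda>t. g (x + (t * s) *\<^sub>R axis i 1)"
  have d: "(?f has_derivative (\<lambda>h. partial i g (x + (t * s) *\<^sub>R axis i 1) * (h * s))) (at t within {0..1})" for t
    by (rule has_derivative_at_withinI)
       (rule has_derivative_compose[OF _ partial_has_derivative[OF pd]], auto intro!: derivative_eq_intros)
  \<comment> \<open>The segment is scaled to the unit interval, so the sign of \<open>s\<close> does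
    not matter.\<close>
  obtain t where t: "t \<in> {0..1}" "?f 1 - ?f 0 = partial i g (x + (t * s) *\<^sub>R axis i 1) * ((1 - 0) * s)"
    using mvt_very_simple[of 0 1 ?f "\<lambda>t h. partial i g (x + (t * s) *\<^sub>R axis i 1) * (h * s)"] d by auto
  have "\<bar>partial i g (x + (t * s) *\<^sub>R axis i 1) - partial i g x\<bar> \<le> M * \<bar>t * s\<bar>"
    using lipschitz_onD[OF lip, of "x + (t * s) *\<^sub>R axis i 1" x] by (simp add: dist_norm)
  also have "\<dots> \<le> M * \<bar>s\<bar>"
    using t(1) lipschitz_on_nonneg[OF lip] by (auto simp: abs_mult intro!: mult_left_mono mult_left_le_one_le)
  finally have "\<bar>partial i g (x + (t * s) *\<^sub>R axis i 1) - p\<bar> \<le> \<bar>partial i g x - p\<bar> + M * \<bar>s\<bar>"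
    by linarith
  moreover have "g (x + s *\<^sub>R axis i 1) - g x - s * p = s * (partial i g (x + (t * s) *\<^sub>R axis i 1) - p)"
    using t(2) by (simp add: algebra_simps)
  ultimately show ?thesis
    by (simp add: abs_mult mult_left_mono)
qed

text \<open>Changing the coordinates one at a time makes the remainder of the linearization quadratic.\<close>

lemma lipschitz_partials_remainder:
  fixes g :: "real^'n \<Rightarrow> real"
  assumes pd: "\<And>i x. partially_differentiable i g x"
    and lip: "\<And>i. (M i)-lipschitz_on UNIV (partial i g)"
  shows "\<bar>g (x + h) - g x - grad g x \<bullet> h\<bar> \<le> (\<Sum>i\<in>UNIV. 2 * M i) * (norm h)\<^sup>2"
proof -
  \<comment> \<open>\<open>r S\<close> is \<open>h\<close> with all coordinates outside
    \<open>S\<close> set to zero; adding an index to \<open>S\<close> moves the point along a single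
    axis.\<close>
  define r where "r = (\<lambda>S. \<Sum>i\<in>S. (h $ i) *\<^sub>R (axis i 1 :: real^'n))"
  have r_nth: "r S $ j = (if j \<in> S then h $ j else 0)" for S j
    unfolding r_def by (simp add: axis_def if_distrib cong: if_cong)
  have norm_r: "norm (r S) \<le> norm h" for S
    by (rule norm_le_componentwise_cart) (simp add: r_nth)
  have "\<bar>g (x + r S) - g x - (\<Sum>i\<in>S. h $ i * partial i g x)\<bar> \<le> (\<Sum>i\<in>S. 2 * M i) * (norm h)\<^sup>2" if "finite S" for S
    using that
  proof (induction S)
    case empty
    then show ?case by (simp add: r_def)
  next
    case (insert i S)
    have M: "0 \<le> M i" using lip lipschitz_on_nonneg by blast
    have "r (insert i S) = r S + (h $ i) *\<^sub>R axis i 1"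
      using insert by (simp add: r_def add.commute)
    then have "\<bar>g (x + r (insert i S)) - g (x + r S) - h $ i * partial i g x\<bar>
        \<le> \<bar>h $ i\<bar> * (\<bar>partial i g (x + r S) - partial i g x\<bar> + M i * \<bar>h $ i\<bar>)"
      using increment_along_axis[OF pd lip[of i], where x = "x + r S" and s = "h $ i" and p = "partial i g x"]
      by (simp add: add.assoc)
    \<comment> \<open>One term pays for the displacement \<open>r S\<close> already made, the other
      for the new step; this is the origin of the factor 2.\<close>
    also have "\<dots> \<le> norm h * (M i * norm h + M i * norm h)"
    proof (intro mult_mono add_mono)
      have "\<bar>partial i g (x + r S) - partial i g x\<bar> \<le> M i * norm (r S)"
        using lipschitz_onD[OF lip[of i], of "x + r S" x] by (simp add: dist_norm)
      also have "\<dots> \<le> M i * norm h"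
        by (intro mult_left_mono norm_r M)
      finally show "\<bar>partial i g (x + r S) - partial i g x\<bar> \<le> M i * norm h" .
    qed (use M component_le_norm_cart[of h i] in auto)
    finally show ?case
      using insert by (simp add: power2_eq_square algebra_simps)
  qed
  from this[of UNIV] have "\<bar>g (x + r UNIV) - g x - (\<Sum>i\<in>UNIV. h $ i * partial i g x)\<bar>
      \<le> (\<Sum>i\<in>UNIV. 2 * M i) * (norm h)\<^sup>2"
    by simp
  moreover have "r UNIV = h"
    by (simp add: vec_eq_iff r_nth)
  ultimately show ?thesis
    by (simp add: grad_def inner_vec_def mult.commute)
qed

text \<open>A quadratic remainder divided by \<open>norm (y - x)\<close> tends to 0. Applied to the
  first partial derivatives of \<open>J\<close>, this turns the assumption on second partials into
  Frechet differentiability of the gradient.\<close>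

lemma lipschitz_partials_imp_differentiable:
  fixes g :: "real^'n \<Rightarrow> real"
  assumes pd: "\<And>i x. partially_differentiable i g x"
    and lip: "\<And>i. \<exists>M. M-lipschitz_on UNIV (partial i g)"
  shows "g differentiable (at x)"
proof -
  obtain M where M: "\<And>i. (M i)-lipschitz_on UNIV (partial i g)"
    using lip by metis
  define K where "K = (\<Sum>i\<in>UNIV. 2 * M i)"
  have "(g has_derivative (\<lambda>h. grad g x \<bullet> h)) (at x)"
  proof (rule has_derivativeI_sandwich[of 1 _ _ _ _ "\<lambda>y. K * norm (y - x)"])
    fix y assume "y \<noteq> x"
    then show "norm (g y - g x - grad g x \<bullet> (y - x)) / norm (y - x) \<le> K * norm (y - x)"
      using lipschitz_partials_remainder[OF pd M, of x "y - x"]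
      by (simp add: K_def divide_le_eq power2_eq_square)
  next
    have "((\<lambda>y. K * norm (y - x)) \<longlongrightarrow> K * norm (x - x)) (at x)"
      by (intro tendsto_intros)
    then show "((\<lambda>y. K * norm (y - x)) \<longlongrightarrow> 0) (at x)" by simp
  qed (auto intro: bounded_linear_inner_right)
  then show ?thesis
    unfolding differentiable_def by blast
qed

subsection \<open>Projection onto an affine set\<close>

text \<open>Orthogonality makes Pythagoras applicable, so no point of \<open>S\<close> is closer to
  \<open>x\<close> than \<open>p\<close>; closest points in a closed convex set are unique.\<close>

lemma affine_closest_point_eqI:
  fixes S :: "'a::euclidean_space set"
  assumes "affine S" "p \<in> S" "\<And>y. y \<in> S \<Longrightarrow> (x - p) \<bullet> (y - p) = 0"
  shows "closest_point S x = p"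
proof (rule closest_point_unique[symmetric])
  show "\<forall>z\<in>S. dist x p \<le> dist x z"
  proof
    fix z assume z: "z \<in> S"
    have "(norm (x - z))\<^sup>2 = (norm ((x - p) - (z - p)))\<^sup>2" by simp
    also have "\<dots> = (norm (x - p))\<^sup>2 + (norm (z - p))\<^sup>2"
      using assms(3)[OF z] by (simp only: dot_norm_neg[of "x - p" "z - p"]) simp
    finally have "(norm (x - p))\<^sup>2 \<le> (norm (x - z))\<^sup>2" by simp
    then show "dist x p \<le> dist x z"
      by (simp add: dist_norm)
  qed
qed (use assms in \<open>auto simp: affine_imp_convex affine_closed\<close>)

text \<open>Together with \<open>y\<close>, its reflection in the projection lies in the affine set.
  The variational inequality for both points gives both signs, hence equality.\<close>

lemma affine_closest_point_orthogonal:
  fixes S :: "'a::euclidean_space set"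
  assumes "affine S" "y \<in> S"
  shows "(x - closest_point S x) \<bullet> (y - closest_point S x) = 0"
proof -
  let ?p = "closest_point S x"
  have p: "?p \<in> S"
    using assms affine_closed closest_point_in_set by blast
  have "?p + (- (y - ?p)) \<in> S"
    using mem_affine[OF assms(1) p assms(2), of 2 "-1"] by (simp add: algebra_simps scaleR_2)
  then have "(x - ?p) \<bullet> (- (y - ?p)) \<le> 0"
    using closest_point_dot[OF affine_imp_convex[OF assms(1)] affine_closed[OF assms(1)], of "?p + (- (y - ?p))" x]
    by (simp only: add_diff_cancel_left')
  moreover have "(x - ?p) \<bullet> (y - ?p) \<le> 0"
    using assms by (simp add: closest_point_dot affine_imp_convex affine_closed)
  ultimately show ?thesis by (simp only: inner_minus_right)
qed

text \<open>With the origin moved to \<open>c\<close>, the orthogonality conditions that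
  characterize the projection are linear in \<open>x\<close>; sums and multiples of projections
  satisfy them again and are therefore the projections of the sums and multiples.\<close>

lemma linear_closest_point_affine:
  fixes S :: "'a::euclidean_space set"
  assumes S: "affine S" and c: "c \<in> S"
  shows "linear (\<lambda>x. closest_point S (c + x) - c)"
proof -
  let ?p = "\<lambda>x. closest_point S (c + x)"
  have p: "?p x \<in> S" for x
    using S c affine_closed closest_point_in_set by blast
  have orth: "(c + x - ?p x) \<bullet> (y - z) = 0" if "y \<in> S" "z \<in> S" for x y z
    using affine_closest_point_orthogonal[OF S that(1), of "c + x"]
      affine_closest_point_orthogonal[OF S that(2), of "c + x"]
    by (simp add: inner_diff_right)
  show ?thesis
  proof
    fix x y
    have q: "?p x + ?p y - c \<in> S"
      using mem_affine_3[OF S p[of x] p[of y] c, of 1 1 "-1"] by simp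
    have "?p (x + y) = ?p x + ?p y - c"
    proof (rule affine_closest_point_eqI[OF S q])
      fix z assume z: "z \<in> S"
      have "c + (x + y) - (?p x + ?p y - c) = (c + x - ?p x) + (c + y - ?p y)" by simp
      then show "(c + (x + y) - (?p x + ?p y - c)) \<bullet> (z - (?p x + ?p y - c)) = 0"
        by (simp only: inner_add_left orth[OF z q])
    qed
    then show "?p (x + y) - c = (?p x - c) + (?p y - c)" by simp
  next
    fix r x
    have q: "c + r *\<^sub>R (?p x - c) \<in> S"
      using mem_affine[OF S c p[of x], of "1 - r" r] by (simp add: algebra_simps)
    have "?p (r *\<^sub>R x) = c + r *\<^sub>R (?p x - c)"
    proof (rule affine_closest_point_eqI[OF S q])
      fix z assume z: "z \<in> S"
      have "c + r *\<^sub>R x - (c + r *\<^sub>R (?p x - c)) = r *\<^sub>R (c + x - ?p x)"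
        by (simp add: algebra_simps)
      then show "(c + r *\<^sub>R x - (c + r *\<^sub>R (?p x - c))) \<bullet> (z - (c + r *\<^sub>R (?p x - c))) = 0"
        by (simp only: inner_scaleR_left orth[OF z q])
    qed
    then show "?p (r *\<^sub>R x) - c = r *\<^sub>R (?p x - c)" by simp
  qed
qed

text \<open>The projection is a translate of a linear map. Affinity of the set is essential here:
  projection onto a general convex set can have kinks.\<close>

lemma differentiable_closest_point_affine:
  fixes S :: "'a::euclidean_space set"
  assumes "affine S" "S \<noteq> {}"
  shows "closest_point S differentiable (at x)"
proof -
  obtain c where c: "c \<in> S" using assms by blast
  define P where "P = (\<lambda>x. closest_point S (c + x) - c)"
  have "P differentiable (at y)" for y
    unfolding P_def
    by (rule linear_imp_differentiable[OF linear_closest_point_affine[OF assms(1) c]])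
  then have "(\<lambda>x. c + P (x - c)) differentiable (at x)"
    by (intro derivative_intros differentiable_compose[of P "\<lambda>x. x - c"])
  then show ?thesis by (simp add: P_def)
qed

lemma differentiable_vec_nth_iff:
  fixes f :: "'a::real_normed_vector \<Rightarrow> real^'n"
  shows "f differentiable (at a within S) \<longleftrightarrow> (\<forall>i. (\<lambda>x. f x $ i) differentiable (at a within S))"
  by (subst differentiable_componentwise_within) (auto simp: Basis_vec_def inner_axis)

subsection \<open>Block matrices and the system response\<close>

text \<open>Action of a block matrix on a signal, that is, a sequence of vectors. The value 0 beyond
  \<open>N\<close> turns matrix identities up to \<open>blk_eq\<close> into plain equalities of
  functions.\<close>

definition blk_apply ::
  "nat \<Rightarrow> ('r::finite, 'c::finite) blkmat \<Rightarrow> (nat \<Rightarrow> real^'c) \<Rightarrow> nat \<Rightarrow> real^'r" where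
  "blk_apply N X x = (\<lambda>k. if k \<le> N then \<Sum>l\<le>N. X k l *v x l else 0)"

lemma matrix_vector_mult_sum_left: "(\<Sum>i\<in>I. M i) *v x = (\<Sum>i\<in>I. M i *v (x :: real^'c::finite))"
  by (induction I rule: infinite_finite_induct) (simp_all add: matrix_vector_mult_add_rdistrib)

lemma matrix_vector_mult_sum_right: "M *v (\<Sum>i\<in>I. x i) = (\<Sum>i\<in>I. M *v (x i :: real^'c::finite))"
  by (induction I rule: infinite_finite_induct) (simp_all add: matrix_vector_right_distrib)

lemma matrix_mult_sum_left: "(\<Sum>i\<in>I. M i) ** X = (\<Sum>i\<in>I. M i ** (X :: real^'c::finite^'r::finite))"
  by (induction I rule: infinite_finite_induct) (simp_all add: matrix_matrix_mult_def vec_eq_iff sum.distrib distrib_right)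

lemma matrix_mult_sum_right: "X ** (\<Sum>i\<in>I. M i) = (\<Sum>i\<in>I. (X :: real^'c::finite^'r::finite) ** M i)"
  by (induction I rule: infinite_finite_induct) (simp_all add: matrix_add_ldistrib)

lemma blk_mult_assoc: "blk_mult N (blk_mult N X Y) Z = blk_mult N X (blk_mult N Y Z)"
proof -
  have "(\<Sum>l\<le>N. (\<Sum>i\<le>N. X k i ** Y i l) ** Z l j) = (\<Sum>i\<le>N. X k i ** (\<Sum>l\<le>N. Y i l ** Z l j))" for k j
    unfolding matrix_mult_sum_left matrix_mult_sum_right matrix_mul_assoc
    by (rule sum.swap)
  then show ?thesis by (simp add: blk_mult_def)
qed

lemma blk_apply_mult: "blk_apply N (blk_mult N X Y) x = blk_apply N X (blk_apply N Y x)"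
proof -
  have "(\<Sum>l\<le>N. (\<Sum>i\<le>N. X k i ** Y i l) *v x l) = (\<Sum>i\<le>N. X k i *v (\<Sum>l\<le>N. Y i l *v x l))" for k
    unfolding matrix_vector_mult_sum_left matrix_vector_mult_sum_right matrix_vector_mul_assoc
    by (rule sum.swap)
  then show ?thesis by (simp add: blk_mult_def blk_apply_def fun_eq_iff)
qed

lemma blk_apply_minus_left:
  "blk_apply N (blk_minus X Y) x = (\<lambda>k. blk_apply N X x k - blk_apply N Y x k)"
  by (simp add: blk_apply_def blk_minus_def matrix_vector_mult_diff_rdistrib sum_subtractf fun_eq_iff)

lemma blk_apply_minus_right:
  "blk_apply N X (\<lambda>k. x k - y k) = (\<lambda>k. blk_apply N X x k - blk_apply N X y k)"
  by (simp add: blk_apply_def matrix_vector_mult_diff_distrib sum_subtractf fun_eq_iff)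

lemma blk_apply_blk_eq: "blk_eq N X Y \<Longrightarrow> blk_apply N X x = blk_apply N Y x"
  by (simp add: blk_apply_def blk_eq_def fun_eq_iff)

lemma blk_apply_diag: "blk_apply N (blk_diag M) x = (\<lambda>k. if k \<le> N then M k *v x k else 0)"
proof -
  have "(\<Sum>l\<le>N. (if k = l then M k else 0) *v x l) = M k *v x k" if "k \<le> N" for k
    using that by (subst sum.remove[of _ k]) (auto intro: sum.neutral)
  then show ?thesis by (simp add: blk_apply_def blk_diag_def fun_eq_iff)
qed

lemma blk_apply_id: "blk_apply N blk_id x = (\<lambda>k. if k \<le> N then x k else 0)"
  by (simp add: blk_id_def blk_apply_diag fun_eq_iff)

lemma blk_apply_zero: "blk_apply N blk_zero x = (\<lambda>k. 0)"
  by (simp add: blk_zero_def blk_apply_def fun_eq_iff)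

lemma blk_apply_shift:
  "blk_apply N blk_shift x = (\<lambda>k. if k \<le> N then (case k of 0 \<Rightarrow> 0 | Suc j \<Rightarrow> x j) else 0)"
proof -
  have "(\<Sum>l\<le>N. (if Suc k = Suc l then mat 1 else 0) *v x l) = x k" if "Suc k \<le> N" for k
    using that by (subst sum.remove[of _ k]) (auto intro: sum.neutral)
  then show ?thesis by (auto simp: blk_apply_def blk_shift_def fun_eq_iff split: nat.split)
qed

lemma sum_lower_triangular:
  fixes g :: "nat \<Rightarrow> 'a::comm_monoid_add"
  assumes "k \<le> N" "\<And>l. k < l \<Longrightarrow> l \<le> N \<Longrightarrow> g l = 0"
  shows "(\<Sum>l\<le>N. g l) = (\<Sum>l\<le>k. g l)"
  using assms by (intro sum.mono_neutral_right) auto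

text \<open>Causality: the output at time \<open>k\<close> depends on inputs up to time
  \<open>k\<close> only.\<close>

lemma blk_apply_lower_triangular:
  assumes "blk_lower_triangular N X" "k \<le> N"
  shows "blk_apply N X x k = (\<Sum>l\<le>k. X k l *v x l)"
  using assms by (auto simp: blk_apply_def blk_lower_triangular_def intro!: sum_lower_triangular)

lemma blk_lower_triangular_mult:
  assumes "blk_lower_triangular N X" "blk_lower_triangular N Y"
  shows "blk_lower_triangular N (blk_mult N X Y)"
  unfolding blk_lower_triangular_def blk_mult_def
proof (intro allI impI sum.neutral ballI)
  fix k j l assume "k \<le> N" "j \<le> N" "k < j" "l \<in> {..N}"
  then show "X k l ** Y l j = 0"
    using assms by (cases "k < l") (auto simp: blk_lower_triangular_def)
qed

lemma blk_mult_id_left: "blk_eq N (blk_mult N blk_id X) X"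
proof -
  have "(\<Sum>l\<le>N. (if k = l then mat 1 else 0) ** X l j) = X k j" if "k \<le> N" for k j
    using that by (subst sum.remove[of _ k]) (auto intro: sum.neutral)
  then show ?thesis by (auto simp: blk_eq_def blk_id_def blk_diag_def blk_mult_def)
qed

lemma blk_mult_id_right: "blk_eq N (blk_mult N X blk_id) X"
proof -
  have "(\<Sum>l\<le>N. X k l ** (if l = j then mat 1 else 0)) = X k j" if "j \<le> N" for k j
    using that by (subst sum.remove[of _ j]) (auto intro: sum.neutral)
  then show ?thesis by (simp add: blk_eq_def blk_id_def blk_diag_def blk_mult_def)
qed

lemma blk_eq_sym: "blk_eq N X Y \<Longrightarrow> blk_eq N Y X"
  by (simp add: blk_eq_def)

lemma blk_eq_trans [trans]: "blk_eq N X Y \<Longrightarrow> blk_eq N Y Z \<Longrightarrow> blk_eq N X Z"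
  by (simp add: blk_eq_def)

lemma blk_mult_cong: "blk_eq N X X' \<Longrightarrow> blk_eq N Y Y' \<Longrightarrow> blk_eq N (blk_mult N X Y) (blk_mult N X' Y')"
  by (auto simp: blk_eq_def blk_mult_def)

lemma blk_eq_refl: "blk_eq N X X"
  by (simp add: blk_eq_def)

text \<open>\<open>Z = Z (X Y) = (Z X) Y = Y\<close>, read up to \<open>blk_eq\<close>.\<close>

lemma blk_inverse_unique:
  assumes "blk_eq N (blk_mult N Z X) blk_id" "blk_eq N (blk_mult N X Y) blk_id"
  shows "blk_eq N Z Y"
proof -
  have "blk_eq N Z (blk_mult N Z (blk_mult N X Y))"
    by (meson assms(2) blk_eq_refl blk_eq_sym blk_eq_trans blk_mult_cong blk_mult_id_right)
  also have "blk_eq N \<dots> Y"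
    unfolding blk_mult_assoc[symmetric]
    by (meson assms(1) blk_eq_refl blk_eq_trans blk_mult_cong blk_mult_id_left)
  finally show ?thesis .
qed

section \<open>Inverses of unipotent block matrices by forward substitution\<close>

definition blk_unipotent :: "nat \<Rightarrow> ('r::finite, 'r) blkmat \<Rightarrow> bool" where
  "blk_unipotent N X \<longleftrightarrow> blk_lower_triangular N X \<and> (\<forall>k\<le>N. X k k = mat 1)"

text \<open>Solves \<open>X Y = I\<close> for \<open>Y\<close> row by row. As the diagonal blocks of
  \<open>X\<close> are meant to be identities, no block has to be inverted.\<close>

fun blk_forward :: "('r::finite, 'r) blkmat \<Rightarrow> ('r, 'r) blkmat" where
  "blk_forward X k j = (if k = j then mat 1 else 0) - (\<Sum>l<k. X k l ** blk_forward X l j)"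

declare blk_forward.simps [simp del]

lemma blk_forward_upper: "k < j \<Longrightarrow> blk_forward X k j = 0"
  by (induction k rule: less_induct) (subst blk_forward.simps, auto intro!: sum.neutral)

lemma blk_forward_diag: "blk_forward X k k = mat 1"
  by (subst blk_forward.simps) (simp add: blk_forward_upper)

lemma blk_unipotent_forward: "blk_unipotent N (blk_forward X)"
  by (simp add: blk_unipotent_def blk_lower_triangular_def blk_forward_upper blk_forward_diag)

text \<open>Row \<open>k\<close> of the product is row \<open>k\<close> of
  \<open>blk_forward X\<close> plus exactly the sum that the recursion subtracts.\<close>

lemma blk_mult_forward:
  assumes "blk_unipotent N X"
  shows "blk_eq N (blk_mult N X (blk_forward X)) blk_id"
  unfolding blk_eq_def blk_mult_def
proof (intro allI impI)
  fix k j assume k: "k \<le> N" and "j \<le> N"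
  have "(\<Sum>l\<le>N. X k l ** blk_forward X l j) = (\<Sum>l\<le>k. X k l ** blk_forward X l j)"
    using assms k by (intro sum_lower_triangular) (auto simp: blk_unipotent_def blk_lower_triangular_def)
  also have "\<dots> = blk_forward X k j + (\<Sum>l<k. X k l ** blk_forward X l j)"
    using assms k by (simp add: lessThan_Suc_atMost[symmetric] blk_unipotent_def)
  also have "\<dots> = blk_id k j"
    by (subst blk_forward.simps) (simp add: blk_id_def blk_diag_def)
  finally show "(\<Sum>l\<le>N. X k l ** blk_forward X l j) = blk_id k j" .
qed

text \<open>The right inverse is again unipotent, so it has a right inverse itself, which can only be the
  original matrix.\<close>

lemma blk_forward_mult:
  assumes "blk_unipotent N X"
  shows "blk_eq N (blk_mult N (blk_forward X) X) blk_id"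
proof -
  let ?Y = "blk_forward X"
  have Y: "blk_eq N (blk_mult N ?Y (blk_forward ?Y)) blk_id"
    by (rule blk_mult_forward[OF blk_unipotent_forward])
  have "blk_eq N X (blk_forward ?Y)"
    using blk_inverse_unique[OF blk_mult_forward[OF assms] Y] .
  then show ?thesis
    by (meson Y blk_eq_refl blk_eq_trans blk_mult_cong)
qed

text \<open>\<open>blk_inv\<close> is a mere choice of an inverse. Forward substitution shows that
  there is one, and uniqueness lets the chosen one inherit triangularity.\<close>

lemma blk_inv_unipotent:
  assumes "blk_unipotent N X"
  shows "blk_eq N (blk_mult N X (blk_inv N X)) blk_id" "blk_lower_triangular N (blk_inv N X)"
proof -
  have inv: "blk_eq N (blk_mult N X (blk_inv N X)) blk_id \<and> blk_eq N (blk_mult N (blk_inv N X) X) blk_id"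
    unfolding blk_inv_def
    by (rule someI[where x = "blk_forward X"]) (simp add: assms blk_mult_forward blk_forward_mult)
  then show "blk_eq N (blk_mult N X (blk_inv N X)) blk_id" by simp
  have "blk_eq N (blk_inv N X) (blk_forward X)"
    using inv blk_mult_forward[OF assms] blk_inverse_unique by blast
  then show "blk_lower_triangular N (blk_inv N X)"
    by (auto simp: blk_eq_def blk_lower_triangular_def blk_forward_upper)
qed

section \<open>The closed loop expressed through the system response\<close>

lemma output_mat_mult: "output_mat *v x = vtop x"
  by (simp add: output_mat_def vtop_def matrix_vector_mult_def vec_eq_iff if_distrib if_distribR
      cong: if_cong)

text \<open>No dynamics is assumed: \<open>d\<close> is the residual of \<open>(x, u)\<close> in the
  linear system, so as signals \<open>d = IZA X - ZB U\<close>. The first pair of affine constraints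
  identifies \<open>ZB U\<close> with \<open>q\<close>, where
  \<open>\<Phi>\<zeta>d q = \<Phi>\<zeta>v y\<close>; the second pair then recovers \<open>X\<close>
  and \<open>U\<close> from \<open>d\<close>.\<close>

lemma system_response_closed_loop:
  fixes A :: "nat \<Rightarrow> real^('n::finite + 'd::finite)^('n + 'd)"
  assumes resp: "system_response N A B \<Phi>\<zeta>d \<Phi>\<zeta>v \<Phi>\<alpha>d \<Phi>\<alpha>v"
    and u: "\<And>k. k \<le> N \<Longrightarrow> u k = (\<Sum>j\<le>k. feedback_gain N \<Phi>\<zeta>d \<Phi>\<zeta>v \<Phi>\<alpha>d \<Phi>\<alpha>v k j *v vtop (x j))"
    and d: "d 0 = x 0" "\<And>k. k < N \<Longrightarrow> d (Suc k) = x (Suc k) - A k *v x k - B k *v u k"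
    and k: "k \<le> N"
  shows "x k = (\<Sum>j\<le>k. \<Phi>\<zeta>d k j *v d j)" "u k = (\<Sum>j\<le>k. \<Phi>\<alpha>d k j *v d j)"
proof -
  define \<A> where "\<A> = blk_diag (\<lambda>k. if k < N then A k else 0)"
  define \<B> where "\<B> = blk_diag (\<lambda>k. if k < N then B k else 0)"
  define \<C> where "\<C> = blk_diag (\<lambda>_. output_mat :: real^('n + 'd)^'n)"
  define IZA where "IZA = blk_minus blk_id (blk_mult N blk_shift \<A>)"
  define ZB where "ZB = blk_mult N blk_shift \<B>"
  define K where "K = feedback_gain N \<Phi>\<zeta>d \<Phi>\<zeta>v \<Phi>\<alpha>d \<Phi>\<alpha>v"
  have A1d: "blk_eq N (blk_minus (blk_mult N IZA \<Phi>\<zeta>d) (blk_mult N ZB \<Phi>\<alpha>d)) blk_id"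
    and A1v: "blk_eq N (blk_minus (blk_mult N IZA \<Phi>\<zeta>v) (blk_mult N ZB \<Phi>\<alpha>v)) blk_zero"
    and A2d: "blk_eq N (blk_minus (blk_mult N \<Phi>\<zeta>d IZA) (blk_mult N \<Phi>\<zeta>v \<C>)) blk_id"
    and A2v: "blk_eq N (blk_minus (blk_mult N \<Phi>\<alpha>d IZA) (blk_mult N \<Phi>\<alpha>v \<C>)) blk_zero"
    and lower: "blk_lower_triangular N \<Phi>\<zeta>d" "blk_lower_triangular N \<Phi>\<zeta>v"
      "blk_lower_triangular N \<Phi>\<alpha>d" "blk_lower_triangular N \<Phi>\<alpha>v"
    using resp unfolding system_response_def Let_def \<A>_def \<B>_def \<C>_def IZA_def ZB_def by auto
  let ?trunc = "\<lambda>y k. if k \<le> N then y k else 0"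
  define X where "X = ?trunc x"
  define U where "U = ?trunc u"
  define y where "y = blk_apply N \<C> X"
  \<comment> \<open>This is the signal through which the gain acts:
    \<open>K y = \<Phi>\<alpha>v y - \<Phi>\<alpha>d q\<close>.\<close>
  define q where "q = blk_apply N (blk_inv N \<Phi>\<zeta>d) (blk_apply N \<Phi>\<zeta>v y)"
  have IZA_apply: "blk_apply N IZA z =
      (\<lambda>k. if k \<le> N then z k - (case k of 0 \<Rightarrow> 0 | Suc j \<Rightarrow> A j *v z j) else 0)" for z
    by (auto simp: IZA_def \<A>_def blk_apply_minus_left blk_apply_id blk_apply_mult blk_apply_shift
        blk_apply_diag fun_eq_iff split: nat.split)
  have ZB_apply: "blk_apply N ZB z =
      (\<lambda>k. if k \<le> N then (case k of 0 \<Rightarrow> 0 | Suc j \<Rightarrow> B j *v z j) else 0)" for z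
    by (auto simp: ZB_def \<B>_def blk_apply_mult blk_apply_shift
        blk_apply_diag fun_eq_iff split: nat.split)
  \<comment> \<open>The shift makes \<open>\<Z>\<A>\<close> and \<open>\<Z>\<B>\<close> strictly
    lower triangular, so the diagonal blocks of the first constraint read
    \<open>\<Phi>\<zeta>d k k = I\<close>.\<close>
  have uni: "blk_unipotent N \<Phi>\<zeta>d"
    unfolding blk_unipotent_def
  proof (intro conjI allI impI lower)
    fix k assume k: "k \<le> N"
    show "\<Phi>\<zeta>d k k = mat 1"
    proof (rule matrix_eq[THEN iffD2], rule allI)
      fix v :: "real^('n + 'd)"
      \<comment> \<open>A signal supported at time \<open>k\<close> picks out block column
        \<open>k\<close>; the other terms in row \<open>k\<close> come from row \<open>k - 1\<close>
        of this column and vanish by triangularity.\<close>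
      define e where "e = (\<lambda>j. if j = k then v else 0)"
      have apply_e: "blk_apply N M e i = (if i \<le> N then M i k *v v else 0)"
        for M :: "('r::finite, 'n + 'd) blkmat" and i
        using k unfolding blk_apply_def e_def
        by (simp add: if_distrib[of "\<lambda>t. _ *v t"] cong: if_cong)
      have "blk_apply N IZA (blk_apply N \<Phi>\<zeta>d e) k - blk_apply N ZB (blk_apply N \<Phi>\<alpha>d e) k = e k"
        using blk_apply_blk_eq[OF A1d, of e] k
        by (simp add: blk_apply_minus_left blk_apply_mult blk_apply_id fun_eq_iff)
      then have "\<Phi>\<zeta>d k k *v v = v"
        using k lower unfolding IZA_apply ZB_apply apply_e
        by (cases k) (auto simp: e_def blk_lower_triangular_def)
      then show "\<Phi>\<zeta>d k k *v v = mat 1 *v v" by simp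
    qed
  qed
  have dq: "blk_apply N \<Phi>\<zeta>d q = blk_apply N \<Phi>\<zeta>v y"
    using blk_apply_blk_eq[OF blk_inv_unipotent(1)[OF uni], of "blk_apply N \<Phi>\<zeta>v y"]
    unfolding q_def blk_apply_mult blk_apply_id by (auto simp: blk_apply_def)
  have y: "y j = vtop (x j)" if "j \<le> N" for j
    using that by (simp add: y_def \<C>_def blk_apply_diag output_mat_mult X_def)
  have lowerK: "blk_lower_triangular N K"
    using lower blk_lower_triangular_mult[OF blk_lower_triangular_mult[OF lower(3)
          blk_inv_unipotent(2)[OF uni]] lower(2)]
    by (auto simp: K_def feedback_gain_def blk_minus_def blk_lower_triangular_def)
  have "U = blk_apply N K y"
  proof
    fix i show "U i = blk_apply N K y i"
    proof (cases "i \<le> N")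
      case True
      then have "u i = (\<Sum>j\<le>i. K i j *v y j)"
        by (simp add: u y K_def)
      with True show ?thesis
        by (simp add: U_def blk_apply_lower_triangular[OF lowerK])
    qed (simp add: U_def blk_apply_def)
  qed
  then have U: "U = (\<lambda>k. blk_apply N \<Phi>\<alpha>v y k - blk_apply N \<Phi>\<alpha>d q k)"
    by (simp add: K_def feedback_gain_def blk_apply_minus_left blk_apply_mult q_def)
  \<comment> \<open>Apply \<open>ZB\<close> to \<open>U\<close>: the first constraint rewrites
    \<open>ZB\<close> after \<open>\<Phi>\<alpha>v\<close> and after \<open>\<Phi>\<alpha>d\<close>
    by means of \<open>IZA\<close>, and by \<open>dq\<close> the two \<open>IZA\<close> terms
    cancel, leaving \<open>q\<close>.\<close>
  have ZBU: "blk_apply N ZB U = q"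
  proof
    fix k
    have "blk_apply N IZA (blk_apply N \<Phi>\<zeta>v y) k = blk_apply N ZB (blk_apply N \<Phi>\<alpha>v y) k"
      using fun_cong[OF blk_apply_blk_eq[OF A1v, of y], of k]
      by (simp add: blk_apply_minus_left blk_apply_mult blk_apply_zero)
    moreover have "blk_apply N IZA (blk_apply N \<Phi>\<zeta>d q) k - blk_apply N ZB (blk_apply N \<Phi>\<alpha>d q) k = q k"
      using fun_cong[OF blk_apply_blk_eq[OF A1d, of q], of k]
      by (auto simp: blk_apply_minus_left blk_apply_mult blk_apply_id)
         (simp_all add: q_def blk_apply_def)
    ultimately show "blk_apply N ZB U k = q k"
      unfolding U blk_apply_minus_right dq by simp
  qed
  have D: "?trunc d = (\<lambda>k. blk_apply N IZA X k - q k)"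
    unfolding ZBU[symmetric] IZA_apply ZB_apply X_def U_def
    by (auto simp: fun_eq_iff d split: nat.split)
  \<comment> \<open>Since \<open>\<Phi>\<zeta>d q = \<Phi>\<zeta>v y\<close> and \<open>y\<close> is
    the output of \<open>X\<close>, this is the second constraint applied to
    \<open>X\<close>.\<close>
  have "blk_apply N \<Phi>\<zeta>d (?trunc d) k = X k"
    using fun_cong[OF blk_apply_blk_eq[OF A2d, of X], of k] k
    unfolding D blk_apply_minus_right dq
    by (simp add: blk_apply_minus_left blk_apply_mult blk_apply_id y_def)
  then show "x k = (\<Sum>j\<le>k. \<Phi>\<zeta>d k j *v d j)"
    using k by (simp add: X_def blk_apply_lower_triangular[OF lower(1)])
  have "blk_apply N \<Phi>\<alpha>d (?trunc d) k = U k"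
    using fun_cong[OF blk_apply_blk_eq[OF A2v, of X], of k]
    unfolding D blk_apply_minus_right U
    by (simp add: blk_apply_minus_left blk_apply_mult blk_apply_zero y_def)
  then show "u k = (\<Sum>j\<le>k. \<Phi>\<alpha>d k j *v d j)"
    using k by (simp add: U_def blk_apply_lower_triangular[OF lower(3)])
qed

subsection \<open>Linearization error of the projected gradient dynamics\<close>

lemma linear_vtop: "linear vtop" and linear_vbot: "linear vbot"
  by (auto intro!: linearI simp: vtop_add vbot_add vtop_scaleR vbot_scaleR)

lemma differentiable_vstack:
  fixes f :: "'a::real_normed_vector \<Rightarrow> real^'m::finite" and g :: "'a \<Rightarrow> real^'k::finite"
  assumes "f differentiable (at x)" "g differentiable (at x)"
  shows "(\<lambda>x. vstack (f x) (g x)) differentiable (at x)"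
  using assms by (auto simp: differentiable_vec_nth_iff split_sum_all)

text \<open>Smoothness is assumed for \<open>J\<close> as a function of the stacked variable, while
  the dynamics uses the gradient in \<xi> alone; both have the same partial derivatives.\<close>

lemma grad_first_argument:
  "grad (\<lambda>x. J x \<theta>) \<xi> = (\<chi> i. partial (Inl i) (\<lambda>z. J (vtop z) (vbot z)) (vstack \<xi> \<theta>))"
proof -
  have "vtop (vstack \<xi> \<theta> + t *\<^sub>R axis (Inl i) 1) = \<xi> + t *\<^sub>R axis i 1"
    "vbot (vstack \<xi> \<theta> + t *\<^sub>R axis (Inl i) 1) = \<theta>" for t i
    by (auto simp: vec_eq_iff axis_def)
  then show ?thesis by (simp add: grad_def partial_def)
qed

text \<open>The map is composed of coordinate projections, a product of the steplength with a
  differentiable gradient, and an affine projection. The steplength is the last entry of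
  \<open>w\<close>, so differentiability is joint in state and steplength.\<close>

lemma differentiable_pgd_dyn:
  fixes J :: "real^'n \<Rightarrow> real^'d \<Rightarrow> real" and w :: "real^(('n + 'd) + 1)"
  assumes J: "lipschitz_second_partials (\<lambda>z. J (vtop z) (vbot z))"
    and SC: "affine SC" "SC \<noteq> {}"
  shows "(\<lambda>w. pgd_dyn SC J (vtop w) (vbot w $ 1)) differentiable (at w)"
proof -
  let ?G = "\<lambda>z :: real^('n + 'd). J (vtop z) (vbot z)"
  have comp: "(\<lambda>w. h (vtop w)) differentiable (at w)"
    if "\<And>z. h differentiable (at z)" for h :: "real^('n + 'd) \<Rightarrow> 'c::real_normed_vector"
    by (rule differentiable_compose[OF that linear_imp_differentiable[OF linear_vtop]])
  have lin: "vtop differentiable (at z)" "vbot differentiable (at z)" for z :: "real^('a::finite + 'b::finite)"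
    by (simp_all add: linear_imp_differentiable linear_vtop linear_vbot)
  have "partial (Inl i) ?G differentiable (at z)" for i z
    using J by (intro lipschitz_partials_imp_differentiable) (auto simp: lipschitz_second_partials_def)
  then have "(\<lambda>w::real^(('n + 'd) + 1). \<chi> i. partial (Inl i) ?G (vtop w)) differentiable (at w)"
    by (subst differentiable_vec_nth_iff) (simp add: comp)
  moreover have "(\<lambda>w::real^(('n + 'd) + 1). vbot w $ 1) differentiable (at w)"
    using lin(2)[of w, unfolded differentiable_vec_nth_iff] by blast
  ultimately have "(\<lambda>w. vtop (vtop w) - vbot w $ 1 *\<^sub>R (\<chi> i. partial (Inl i) ?G (vtop w))) differentiable (at w)"
    using comp[of vtop, OF lin(1)] by (intro derivative_intros)
  then have "(\<lambda>w. closest_point SC (vtop (vtop w) - vbot w $ 1 *\<^sub>R (\<chi> i. partial (Inl i) ?G (vtop w))))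
      differentiable (at w)"
    by (rule differentiable_compose[OF differentiable_closest_point_affine[OF SC]])
  then have "(\<lambda>w. vstack (closest_point SC (vtop (vtop w) - vbot w $ 1 *\<^sub>R (\<chi> i. partial (Inl i) ?G (vtop w))))
      (vbot (vtop w))) differentiable (at w)"
    by (rule differentiable_vstack) (rule comp[OF lin(2)])
  then show ?thesis
    by (simp add: pgd_dyn_def pgd_step_def grad_first_argument)
qed

text \<open>Chain rule along the two slices through \<open>(z, a)\<close>: each partial Jacobian is
  the joint derivative restricted to one block of directions.\<close>

lemma jacobian_partition:
  fixes f :: "real^'z::finite \<Rightarrow> real^'k::finite \<Rightarrow> real^'m::finite"
  assumes "((\<lambda>w. f (vtop w) (vbot w)) has_derivative f') (at (vstack z a))"
  shows "f' (vstack h b) = jacobian (\<lambda>z. f z a) (at z) *v h + jacobian (\<lambda>a. f z a) (at a) *v b"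
proof -
  have jac: "jacobian g (at x) *v y = g' y"
    if "(g has_derivative g') (at x)" for g :: "real^'c::finite \<Rightarrow> real^'m" and g' x y
    using that jacobian_works[of g "at x"] has_derivative_unique[of g g' x]
    by (metis differentiableI)
  have bl: "bounded_linear (\<lambda>h. vstack h (0 :: real^'k) :: real^('z + 'k))"
    "bounded_linear (\<lambda>b. vstack (0 :: real^'z) b :: real^('z + 'k))"
    by (auto simp: linear_conv_bounded_linear[symmetric] vec_sum_eq_iff intro!: linearI)
  \<comment> \<open>The slice is written as a constant plus a linear map, so that its derivative is
    immediate.\<close>
  have "((\<lambda>x. vstack 0 a + vstack x 0) has_derivative (\<lambda>h. vstack h 0)) (at z)"
    using bounded_linear_imp_has_derivative[OF bl(1)] by (auto intro!: derivative_eq_intros)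
  then have "((\<lambda>x. vstack x a) has_derivative (\<lambda>h. vstack h 0)) (at z)"
    by (simp flip: vstack_add)
  from has_derivative_compose[OF this assms]
  have h: "jacobian (\<lambda>z. f z a) (at z) *v h = f' (vstack h 0)"
    by (intro jac) simp
  have "((\<lambda>x. vstack z 0 + vstack 0 x) has_derivative (\<lambda>h. vstack 0 h)) (at a)"
    using bounded_linear_imp_has_derivative[OF bl(2)] by (auto intro!: derivative_eq_intros)
  then have "((\<lambda>x. vstack z x) has_derivative (\<lambda>h. vstack 0 h)) (at a)"
    by (simp flip: vstack_add)
  from has_derivative_compose[OF this assms]
  have b: "jacobian (\<lambda>a. f z a) (at a) *v b = f' (vstack 0 b)"
    by (intro jac) simp
  have "f' (vstack h b) = f' (vstack h 0 + vstack 0 b)"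
    by (simp flip: vstack_add)
  also have "\<dots> = f' (vstack h 0) + f' (vstack 0 b)"
    using has_derivative_linear[OF assms] by (simp add: linear_add)
  finally show ?thesis by (simp add: h b)
qed

section \<open>Dual norm estimates and the second-order remainder\<close>

lemma abs_inner_le_l1norm_infnorm: "\<bar>x \<bullet> y\<bar> \<le> l1norm x * infnorm y"
proof -
  have "\<bar>x \<bullet> y\<bar> \<le> (\<Sum>i\<in>UNIV. \<bar>x $ i\<bar> * \<bar>y $ i\<bar>)"
    unfolding inner_vec_def by (rule order_trans[OF sum_abs]) (simp add: abs_mult)
  also have "\<dots> \<le> (\<Sum>i\<in>UNIV. \<bar>x $ i\<bar> * infnorm y)"
    by (intro sum_mono mult_left_mono component_le_infnorm_cart) simp
  finally show ?thesis by (simp add: l1norm_def sum_distrib_right)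
qed

lemma l1norm_nonneg: "0 \<le> l1norm x"
  by (simp add: l1norm_def sum_nonneg)

lemma infnorm_leI: "infnorm x \<le> b" if "\<And>i. \<bar>x $ i\<bar> \<le> b" for x :: "real^'n"
  unfolding infnorm_cart using that by (intro cSup_least) auto

lemma infnorm_sum: "infnorm (\<Sum>i\<in>I. f i :: real^'n) \<le> (\<Sum>i\<in>I. infnorm (f i))"
  by (induction I rule: infinite_finite_induct)
     (auto simp: infnorm_0 intro: order_trans[OF infnorm_triangle])

lemma infnorm_mult_le: "infnorm (A *v x) \<le> mat_infnorm A * infnorm x"
proof (rule infnorm_leI)
  fix i
  have "\<bar>(A *v x) $ i\<bar> \<le> l1norm (row i A) * infnorm x"
    using abs_inner_le_l1norm_infnorm[of "row i A" x]
    by (simp add: matrix_vector_mult_def inner_vec_def row_def)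
  also have "\<dots> \<le> mat_infnorm A * infnorm x"
    unfolding mat_infnorm_def by (intro mult_right_mono Max_ge infnorm_pos_le) auto
  finally show "\<bar>(A *v x) $ i\<bar> \<le> mat_infnorm A * infnorm x" .
qed

lemma mat_infnorm_nonneg: "0 \<le> mat_infnorm A"
proof -
  \<comment> \<open>Any row index will do; \<open>undefined\<close> just names one.\<close>
  have "0 \<le> l1norm (row undefined A)" by (rule l1norm_nonneg)
  also have "\<dots> \<le> mat_infnorm A"
    unfolding mat_infnorm_def by (rule Max_ge) auto
  finally show ?thesis .
qed

text \<open>The mean value theorem on the segment turns the remainder into a gradient difference
  paired with \<open>y - x\<close>; the l1 and maximum norms are dual. The resulting constant \<mu>,
  without a factor 1/2, is the one in the tightened constraints.\<close>

lemma lipschitz_gradient_remainder: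
  fixes g :: "real^'n \<Rightarrow> real"
  assumes diff: "\<And>x. x \<in> D \<Longrightarrow> g differentiable (at x)"
    and D: "convex D" "x \<in> D" "y \<in> D"
    and \<mu>: "0 \<le> \<mu>"
    and lip: "\<And>z. z \<in> D \<Longrightarrow> l1norm (grad g z - grad g x) \<le> \<mu> * infnorm (z - x)"
  shows "\<bar>g y - g x - grad g x \<bullet> (y - x)\<bar> \<le> \<mu> * (infnorm (y - x))\<^sup>2"
proof -
  let ?l = "\<lambda>t. x + t *\<^sub>R (y - x)"
  have l: "?l t \<in> D" if "t \<in> {0..1}" for t
    using convexD_alt[OF D, of t] that by (simp add: algebra_simps)
  have deriv: "((\<lambda>t. g (?l t)) has_derivative (\<lambda>h. grad g (?l t) \<bullet> (h *\<^sub>R (y - x)))) (at t within {0..1})"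
    if t: "t \<in> {0..1}" for t
  proof -
    obtain g' where g': "(g has_derivative g') (at (?l t))"
      using diff[OF l[OF t]] by (auto simp: differentiable_def)
    have "(g has_derivative (\<lambda>h. grad g (?l t) \<bullet> h)) (at (?l t))"
      using g' by (simp add: has_derivative_imp_grad[OF g', symmetric])
    moreover have "(?l has_derivative (\<lambda>h. h *\<^sub>R (y - x))) (at t within {0..1})"
      by (auto intro!: derivative_eq_intros)
    ultimately show ?thesis
      by (rule has_derivative_compose[rotated])
  qed
  obtain t where t: "t \<in> {0..1}" "g (?l 1) - g (?l 0) = grad g (?l t) \<bullet> ((1 - 0) *\<^sub>R (y - x))"
    using mvt_very_simple[of 0 1 "\<lambda>t. g (?l t)" "\<lambda>t h. grad g (?l t) \<bullet> (h *\<^sub>R (y - x))"] deriv by auto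
  have "\<bar>g y - g x - grad g x \<bullet> (y - x)\<bar> = \<bar>(grad g (?l t) - grad g x) \<bullet> (y - x)\<bar>"
    using t(2) by (simp add: inner_diff_left)
  also have "\<dots> \<le> l1norm (grad g (?l t) - grad g x) * infnorm (y - x)"
    by (rule abs_inner_le_l1norm_infnorm)
  also have "\<dots> \<le> (\<mu> * infnorm (y - x)) * infnorm (y - x)"
  proof (rule mult_right_mono[OF _ infnorm_pos_le])
    have "infnorm (?l t - x) \<le> infnorm (y - x)"
      using t(1) infnorm_pos_le[of "y - x"] by (simp add: infnorm_mul mult_left_le_one_le)
    then show "l1norm (grad g (?l t) - grad g x) \<le> \<mu> * infnorm (y - x)"
      using lip[OF l[OF t(1)]] mult_left_mono[OF _ \<mu>] by (meson order_trans)
  qed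
  finally show ?thesis by (simp add: power2_eq_square mult.assoc)
qed

section \<open>Trajectories, reachable sets and the linearization error\<close>

lemma pgd_dyn_trajectory:
  assumes "z 0 = vstack \<xi>0 \<theta>" "\<And>k. k < N \<Longrightarrow> z (Suc k) = pgd_dyn SC J (z k) (a k)" "k \<le> N"
  shows "z k = vstack (pgd_iter SC J \<xi>0 \<theta> a k) \<theta>"
  using assms(3) by (induction k) (simp_all add: assms pgd_dyn_def)

lemma pgd_iter_in_reach_hull:
  assumes "\<xi>0 \<in> S0" "\<theta> \<in> \<Theta>" "\<And>i. i < k \<Longrightarrow> a i \<in> {c\<alpha>..C\<alpha>}"
  shows "pgd_iter SC J \<xi>0 \<theta> a k \<in> reach_hull SC J \<Theta> S0 c\<alpha> C\<alpha>"
  unfolding reach_hull_def reach_set_def using assms by (intro hull_inc) blast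

text \<open>The remainder bound is applied to each coordinate of the dynamics as a function of
  \<open>(\<zeta>, \<alpha>)\<close>, linearized at \<open>(z, a)\<close>.\<close>

lemma pgd_dyn_linearization_error:
  fixes J :: "real^'n \<Rightarrow> real^'d \<Rightarrow> real" and z z' :: "real^('n + 'd)"
  assumes J: "lipschitz_second_partials (\<lambda>z. J (vtop z) (vbot z))"
    and SC: "affine SC" "SC \<noteq> {}" and \<Theta>: "convex \<Theta>"
    and \<mu>: "curvature_constants SC J \<Theta> S0 c\<alpha> C\<alpha> \<mu>"
    and z: "vtop z \<in> reach_hull SC J \<Theta> S0 c\<alpha> C\<alpha>" "vbot z \<in> \<Theta>" "a \<in> {c\<alpha>..C\<alpha>}"
    and z': "vtop z' \<in> reach_hull SC J \<Theta> S0 c\<alpha> C\<alpha>" "vbot z' \<in> \<Theta>" "a' \<in> {c\<alpha>..C\<alpha>}"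
  shows "\<bar>(pgd_dyn SC J z' a' - pgd_dyn SC J z a
          - jacobian (\<lambda>z. pgd_dyn SC J z a) (at z) *v (z' - z)
          - jacobian (\<lambda>b :: real^1. pgd_dyn SC J z (b $ 1)) (at (vec a)) *v vec (a' - a)) $ i\<bar>
        \<le> \<mu> $ i * (infnorm (vstack (z' - z) (vec (a' - a)) :: real^(('n + 'd) + 1)))\<^sup>2"
proof -
  let ?H = "reach_hull SC J \<Theta> S0 c\<alpha> C\<alpha>"
  define D where "D = {vstack (vstack \<xi> \<theta>) (vec \<alpha>) :: real^(('n + 'd) + 1) | \<xi> \<theta> \<alpha>.
                 \<xi> \<in> ?H \<and> \<theta> \<in> \<Theta> \<and> \<alpha> \<in> {c\<alpha>..C\<alpha>}}"
  define F where "F = (\<lambda>w :: real^(('n + 'd) + 1). pgd_dyn SC J (vtop w) (vbot w $ 1))"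
  define w w' :: "real^(('n + 'd) + 1)" where "w = vstack z (vec a)" and "w' = vstack z' (vec a')"
  \<comment> \<open>Coordinate form of \<open>D\<close>, which reduces its convexity to that of its
    three factors.\<close>
  have D: "w \<in> D \<longleftrightarrow> vtop (vtop w) \<in> ?H \<and> vbot (vtop w) \<in> \<Theta> \<and> vbot w $ 1 \<in> {c\<alpha>..C\<alpha>}" for w
  proof -
    have "w = vstack (vstack (vtop (vtop w)) (vbot (vtop w))) (vec (vbot w $ 1))"
      by (simp add: vec_sum_eq_iff)
    then show ?thesis unfolding D_def by force
  qed
  have H: "convex ?H"
    unfolding reach_hull_def by (rule convex_convex_hull)
  \<comment> \<open>The segment between the two points has to stay where the curvature constants are
    valid; this is why they are imposed over the convex hull of the reachable sets.\<close>
  have "convex D"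
  proof (rule convexI)
    fix x y and u v :: real
    assume xy: "x \<in> D" "y \<in> D" and uv: "0 \<le> u" "0 \<le> v" "u + v = 1"
    have "u * (vbot x $ 1) + v * (vbot y $ 1) \<in> {c\<alpha>..C\<alpha>}"
      using convexD[OF convex_real_interval(5) _ _ uv] xy unfolding D by (metis real_scaleR_def)
    with xy uv show "u *\<^sub>R x + v *\<^sub>R y \<in> D"
      unfolding D vtop_add vbot_add vtop_scaleR vbot_scaleR
      by (simp add: convexD[OF H] convexD[OF \<Theta>])
  qed
  have diff: "F differentiable (at x)" for x
    unfolding F_def by (rule differentiable_pgd_dyn[OF J SC])
  obtain F' where F': "(F has_derivative F') (at w)"
    using diff by (auto simp: differentiable_def)
  have "jacobian (\<lambda>z. pgd_dyn SC J z a) (at z) *v (z' - z)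
      = F' (w' - w) - jacobian (\<lambda>b :: real^1. pgd_dyn SC J z (b $ 1)) (at (vec a)) *v vec (a' - a)"
    using jacobian_partition[of "\<lambda>z b. pgd_dyn SC J z (b $ 1)" F' z "vec a" "z' - z" "vec (a' - a)"] F'
    unfolding w_def w'_def F_def by (simp add: vec_diff vstack_diff)
  moreover have "F' (w' - w) $ i = grad (\<lambda>w. F w $ i) w \<bullet> (w' - w)"
    using has_derivative_imp_grad[OF bounded_linear.has_derivative[OF bounded_linear_vec_nth[of i] F']] .
  moreover have "F w = pgd_dyn SC J z a" "F w' = pgd_dyn SC J z' a'"
    by (simp_all add: F_def w_def w'_def)
  ultimately have eq: "(pgd_dyn SC J z' a' - pgd_dyn SC J z a
          - jacobian (\<lambda>z. pgd_dyn SC J z a) (at z) *v (z' - z)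
          - jacobian (\<lambda>b :: real^1. pgd_dyn SC J z (b $ 1)) (at (vec a)) *v vec (a' - a)) $ i
      = F w' $ i - F w $ i - grad (\<lambda>w. F w $ i) w \<bullet> (w' - w)"
    by simp
  have \<mu>i: "0 < \<mu> $ i"
    "\<And>w w'. w \<in> D \<Longrightarrow> w' \<in> D \<Longrightarrow>
       l1norm (grad (\<lambda>w. F w $ i) w - grad (\<lambda>w. F w $ i) w') \<le> \<mu> $ i * infnorm (w - w')"
    using \<mu> unfolding curvature_constants_def Let_def D_def[symmetric] F_def by blast+
  have "w \<in> D" "w' \<in> D"
    using z z' by (simp_all add: D w_def w'_def)
  then have "\<bar>F w' $ i - F w $ i - grad (\<lambda>w. F w $ i) w \<bullet> (w' - w)\<bar> \<le> \<mu> $ i * (infnorm (w' - w))\<^sup>2"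
    using diff[unfolded differentiable_vec_nth_iff] \<open>convex D\<close> \<mu>i
    by (intro lipschitz_gradient_remainder[where D = D]) auto
  then show ?thesis
    unfolding eq by (simp add: w_def w'_def vec_diff vstack_diff)
qed

subsection \<open>Robust feasibility\<close>

lemma step_a_inner: "step_a p \<bullet> vstack z a = (if p = 1 then a $ 1 else - (a $ 1))"
  by (simp add: step_a_def inner_vec_def sum.Plus flip: UNIV_Plus_UNIV)

theorem theorem2:
  fixes J :: "real^'n \<Rightarrow> real^'d \<Rightarrow> real"
    and SC S0 :: "(real^'n) set"
    and \<Theta> :: "(real^'d) set"
    and m L c\<alpha> C\<alpha> :: real
    and N :: nat
    and \<xi>0 :: "real^'n"
    and \<theta>hat0 :: "real^'d"
    and \<zeta>hat :: "nat \<Rightarrow> real^('n + 'd)"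
    and \<alpha>hat :: "nat \<Rightarrow> real"
    and \<Phi>\<zeta>d :: "('n + 'd, 'n + 'd) blkmat"
    and \<Phi>\<zeta>v :: "('n + 'd, 'n) blkmat"
    and \<Phi>\<alpha>d :: "(1, 'n + 'd) blkmat"
    and \<Phi>\<alpha>v :: "(1, 'n) blkmat"
    and \<mu> :: "real^('n + 'd)"
    and \<tau> :: "nat \<Rightarrow> real"
  assumes J_smooth: "lipschitz_second_partials (\<lambda>z :: real^('n + 'd). J (vtop z) (vbot z))"
    and mL: "0 < m" "m \<le> L"
    and J_lower: "\<And>\<theta> \<xi> \<xi>'. \<theta> \<in> \<Theta> \<Longrightarrow>
          J \<xi> \<theta> + grad (\<lambda>x. J x \<theta>) \<xi> \<bullet> (\<xi>' - \<xi>) + m / 2 * (norm (\<xi>' - \<xi>))\<^sup>2 \<le> J \<xi>' \<theta>"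
    and J_upper: "\<And>\<theta> \<xi> \<xi>'. \<theta> \<in> \<Theta> \<Longrightarrow>
          J \<xi>' \<theta> \<le> J \<xi> \<theta> + grad (\<lambda>x. J x \<theta>) \<xi> \<bullet> (\<xi>' - \<xi>) + L / 2 * (norm (\<xi>' - \<xi>))\<^sup>2"
    and SC: "affine SC"
    and \<Theta>: "convex \<Theta>" "compact \<Theta>"
    and S0: "S0 \<subseteq> SC" "bounded S0"
    and steps: "c\<alpha> \<in> {0<..<2 / L}" "C\<alpha> \<in> {0<..<2 / L}" "c\<alpha> \<le> C\<alpha>"
    and N: "N \<ge> 1"
    and init: "\<xi>0 \<in> S0" "\<theta>hat0 \<in> \<Theta>"
    and nominal: "\<zeta>hat 0 = vstack \<xi>0 \<theta>hat0"
          "\<And>k. k < N \<Longrightarrow> \<zeta>hat (Suc k) = pgd_dyn SC J (\<zeta>hat k) (\<alpha>hat k)"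
    and response: "system_response N
          (\<lambda>k. jacobian (\<lambda>\<zeta>. pgd_dyn SC J \<zeta> (\<alpha>hat k)) (at (\<zeta>hat k)))
          (\<lambda>k. jacobian (\<lambda>a :: real^1. pgd_dyn SC J (\<zeta>hat k) (a $ 1)) (at (vec (\<alpha>hat k))))
          \<Phi>\<zeta>d \<Phi>\<zeta>v \<Phi>\<alpha>d \<Phi>\<alpha>v"
    and curvature: "curvature_constants SC J \<Theta> S0 c\<alpha> C\<alpha> \<mu>"
    and constraint_tightening: "\<And>k p. k \<le> N \<Longrightarrow> p \<in> {1, 2} \<Longrightarrow>
          step_a p \<bullet> (vstack (\<zeta>hat k) (vec (\<alpha>hat k))) + step_b c\<alpha> C\<alpha> p
          + l1norm (step_a p v* vstack (\<Phi>\<zeta>d k 0) (\<Phi>\<alpha>d k 0)) * diameter \<Theta>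
          + (\<Sum>j = 1..k. (\<tau> (j - 1))\<^sup>2
               * l1norm (step_a p v* (vstack (\<Phi>\<zeta>d k j) (\<Phi>\<alpha>d k j) ** diag_mat \<mu>))) \<le> 0"
    and error_bound: "\<And>k. k \<le> N \<Longrightarrow>
          mat_infnorm (vstack (\<Phi>\<zeta>d k 0) (\<Phi>\<alpha>d k 0)) * diameter \<Theta>
          + (\<Sum>j = 1..k. (\<tau> (j - 1))\<^sup>2
               * mat_infnorm (vstack (\<Phi>\<zeta>d k j) (\<Phi>\<alpha>d k j) ** diag_mat \<mu>)) \<le> \<tau> k"
  shows "\<forall>\<theta>\<in>\<Theta>. \<forall>(\<zeta> :: nat \<Rightarrow> real^('n + 'd)) (\<alpha> :: nat \<Rightarrow> real).
           \<zeta> 0 = vstack \<xi>0 \<theta> \<longrightarrow>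
           (\<forall>k<N. \<zeta> (Suc k) = pgd_dyn SC J (\<zeta> k) (\<alpha> k)) \<longrightarrow>
           (\<forall>k\<le>N. \<alpha> k = \<alpha>hat k +
              (\<Sum>j\<le>k. feedback_gain N \<Phi>\<zeta>d \<Phi>\<zeta>v \<Phi>\<alpha>d \<Phi>\<alpha>v k j *v (vtop (\<zeta> j) - vtop (\<zeta>hat j))) $ 1) \<longrightarrow>
           (\<forall>k\<le>N. infnorm (vstack (\<zeta> k - \<zeta>hat k) (vec (\<alpha> k - \<alpha>hat k)) :: real^(('n + 'd) + 1)) \<le> \<tau> k
                   \<and> \<alpha> k \<in> {c\<alpha>..C\<alpha>})"
proof (intro ballI allI impI conjI)
  fix \<theta> and \<zeta> :: "nat \<Rightarrow> real^('n + 'd)" and \<alpha> :: "nat \<Rightarrow> real" and n :: nat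
  assume \<theta>: "\<theta> \<in> \<Theta>" and \<zeta>0: "\<zeta> 0 = vstack \<xi>0 \<theta>"
    and \<zeta>_Suc: "\<forall>k<N. \<zeta> (Suc k) = pgd_dyn SC J (\<zeta> k) (\<alpha> k)"
    and fb: "\<forall>k\<le>N. \<alpha> k = \<alpha>hat k +
              (\<Sum>j\<le>k. feedback_gain N \<Phi>\<zeta>d \<Phi>\<zeta>v \<Phi>\<alpha>d \<Phi>\<alpha>v k j *v (vtop (\<zeta> j) - vtop (\<zeta>hat j))) $ 1"
    and n: "n \<le> N"
  define A where "A = (\<lambda>k. jacobian (\<lambda>\<zeta>. pgd_dyn SC J \<zeta> (\<alpha>hat k)) (at (\<zeta>hat k)))"
  define B where "B = (\<lambda>k. jacobian (\<lambda>a :: real^1. pgd_dyn SC J (\<zeta>hat k) (a $ 1)) (at (vec (\<alpha>hat k))))"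
  define x where "x = (\<lambda>k. \<zeta> k - \<zeta>hat k)"
  define u where "u = (\<lambda>k. vec (\<alpha> k - \<alpha>hat k) :: real^1)"
  define \<delta> :: "nat \<Rightarrow> real^(('n + 'd) + 1)" where "\<delta> = (\<lambda>k. vstack (x k) (u k))"
  define w where "w = (\<lambda>k. x (Suc k) - A k *v x k - B k *v u k)"
  define d where "d = (\<lambda>k. case k of 0 \<Rightarrow> x 0 | Suc j \<Rightarrow> w j)"
  \<comment> \<open>Disturbance scaled by the curvature constants, with the index shift of
    \<open>d\<close>: \<open>e j\<close> belongs to time \<open>j - 1\<close>. The factor
    \<open>diag_mat \<mu>\<close> thereby moves into the gain, as in the hypotheses.\<close>
  define e where "e = (\<lambda>j. (\<chi> i. w (j - 1) $ i / \<mu> $ i) :: real^('n + 'd))"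
  define M where "M = (\<lambda>k j. vstack (\<Phi>\<zeta>d k j) (\<Phi>\<alpha>d k j))"
  let ?H = "reach_hull SC J \<Theta> S0 c\<alpha> C\<alpha>"
  let ?a = "step_a :: nat \<Rightarrow> real^(('n + 'd) + 1)"
  have u: "u k = (\<Sum>j\<le>k. feedback_gain N \<Phi>\<zeta>d \<Phi>\<zeta>v \<Phi>\<alpha>d \<Phi>\<alpha>v k j *v vtop (x j))" if "k \<le> N" for k
    using fb that by (simp add: u_def x_def vec_eq_iff vtop_diff)
  have resp: "system_response N A B \<Phi>\<zeta>d \<Phi>\<zeta>v \<Phi>\<alpha>d \<Phi>\<alpha>v"
    using response by (simp add: A_def B_def)
  have d: "d 0 = x 0" "\<And>k. k < N \<Longrightarrow> d (Suc k) = x (Suc k) - A k *v x k - B k *v u k"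
    by (simp_all add: d_def w_def)
  have \<mu>_pos: "0 < \<mu> $ i" for i
    using curvature by (simp add: curvature_constants_def Let_def)
  have d_eq: "d j = diag_mat \<mu> *v e j" if "1 \<le> j" for j
    using that \<mu>_pos by (cases j) (simp_all add: d_def e_def diag_mat_mult vec_eq_iff less_imp_neq[symmetric])
  have \<delta>_eq: "\<delta> k = M k 0 *v d 0 + (\<Sum>j = 1..k. (M k j ** diag_mat \<mu>) *v e j)" if "k \<le> N" for k
  proof -
    have "\<delta> k = (\<Sum>j\<le>k. M k j *v d j)"
      using system_response_closed_loop[OF resp u d that]
      by (simp add: \<delta>_def M_def vstack_mult vstack_sum)
    also have "\<dots> = M k 0 *v d 0 + (\<Sum>j = 1..k. M k j *v d j)"
      by (simp add: atMost_atLeast0 sum.atLeast_Suc_atMost)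
    finally show ?thesis
      by (simp add: d_eq matrix_vector_mul_assoc)
  qed
  have bdd: "bounded \<Theta>" using \<Theta> compact_imp_bounded by blast
  have diam: "0 \<le> diameter \<Theta>" by (rule diameter_ge_0[OF bdd])
  \<comment> \<open>Both trajectories start from the same \<xi>0, so only the parameter block is
    nonzero, and the maximum norm is at most the Euclidean one.\<close>
  have d0: "infnorm (d 0) \<le> diameter \<Theta>"
  proof (rule infnorm_leI)
    fix i
    have "\<bar>(\<theta> - \<theta>hat0) $ j\<bar> \<le> diameter \<Theta>" for j
      using component_le_norm_cart[of "\<theta> - \<theta>hat0" j] diameter_bounded_bound[OF bdd \<theta> init(2)]
      by (simp add: dist_norm)
    then show "\<bar>d 0 $ i\<bar> \<le> diameter \<Theta>"
      using diam by (cases i) (simp_all add: d x_def \<zeta>0 nominal)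
  qed
  \<comment> \<open>The tightening terms are nonnegative, so the nominal steplengths are admissible,
    and the nominal iterates lie in the reachable sets.\<close>
  have \<alpha>hat: "\<alpha>hat k \<in> {c\<alpha>..C\<alpha>}" if "k \<le> N" for k
  proof -
    have "?a p \<bullet> vstack (\<zeta>hat k) (vec (\<alpha>hat k)) + step_b c\<alpha> C\<alpha> p \<le> 0" if "p \<in> {1, 2}" for p
    proof -
      have "0 \<le> l1norm (?a p v* M k 0) * diameter \<Theta>
          + (\<Sum>j = 1..k. (\<tau> (j - 1))\<^sup>2 * l1norm (?a p v* (M k j ** diag_mat \<mu>)))"
        by (intro add_nonneg_nonneg sum_nonneg mult_nonneg_nonneg l1norm_nonneg diam) simp
      then show ?thesis
        using constraint_tightening[OF \<open>k \<le> N\<close> that] unfolding M_def by linarith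
    qed
    from this[of 1] this[of 2] show ?thesis
      by (simp add: step_a_inner step_b_def)
  qed
  \<comment> \<open>Both conclusions are carried together: the error bounds control the earlier
    disturbances, and admissible steplengths keep the true trajectory in the reachable sets.\<close>
  have claim: "k \<le> N \<Longrightarrow> infnorm (\<delta> k) \<le> \<tau> k \<and> \<alpha> k \<in> {c\<alpha>..C\<alpha>}" for k
  proof (induction k rule: less_induct)
    case (less k)
    have e: "infnorm (e j) \<le> (\<tau> (j - 1))\<^sup>2" if j: "j \<in> {1..k}" for j
    proof (rule infnorm_leI)
      fix i
      let ?j = "j - 1"
      have j': "?j < k" "?j < N" using j less.prems by auto
      have \<zeta>j: "\<zeta> ?j = vstack (pgd_iter SC J \<xi>0 \<theta> \<alpha> ?j) \<theta>"
        using \<zeta>0 \<zeta>_Suc j' by (intro pgd_dyn_trajectory[where N = N]) auto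
      have \<zeta>hatj: "\<zeta>hat ?j = vstack (pgd_iter SC J \<xi>0 \<theta>hat0 \<alpha>hat ?j) \<theta>hat0"
        using nominal j' by (intro pgd_dyn_trajectory[where N = N]) auto
      \<comment> \<open>The steps before \<open>j - 1\<close> make the state at that time reachable;
        the step at \<open>j - 1\<close> itself is an argument of the linearized map.\<close>
      have "\<alpha> i \<in> {c\<alpha>..C\<alpha>}" if "i \<le> ?j" for i
        using less.IH[of i] that j' by auto
      then have \<zeta>_mem: "vtop (\<zeta> ?j) \<in> ?H" "vbot (\<zeta> ?j) \<in> \<Theta>" "\<alpha> ?j \<in> {c\<alpha>..C\<alpha>}"
        unfolding \<zeta>j vtop_vstack vbot_vstack
        using \<theta> init by (auto intro!: pgd_iter_in_reach_hull simp del: atLeastAtMost_iff)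
      have \<zeta>hat_mem: "vtop (\<zeta>hat ?j) \<in> ?H" "vbot (\<zeta>hat ?j) \<in> \<Theta>" "\<alpha>hat ?j \<in> {c\<alpha>..C\<alpha>}"
        unfolding \<zeta>hatj vtop_vstack vbot_vstack
        using init \<alpha>hat j' by (auto intro!: pgd_iter_in_reach_hull simp del: atLeastAtMost_iff)
      have "w ?j = pgd_dyn SC J (\<zeta> ?j) (\<alpha> ?j) - pgd_dyn SC J (\<zeta>hat ?j) (\<alpha>hat ?j)
          - A ?j *v (\<zeta> ?j - \<zeta>hat ?j) - B ?j *v vec (\<alpha> ?j - \<alpha>hat ?j)"
        using nominal(2)[OF j'(2)] \<zeta>_Suc j'(2) by (simp only: w_def x_def u_def)
      moreover have "SC \<noteq> {}"
        using init S0 by blast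
      ultimately have "\<bar>w ?j $ i\<bar> \<le> \<mu> $ i * (infnorm (\<delta> ?j))\<^sup>2"
        using pgd_dyn_linearization_error[OF J_smooth SC _ \<Theta>(1) curvature \<zeta>hat_mem \<zeta>_mem, of i]
        unfolding A_def B_def \<delta>_def x_def u_def by (simp only:) blast
      also have "\<dots> \<le> \<mu> $ i * (\<tau> ?j)\<^sup>2"
        using less.IH[OF j'(1)] j' \<mu>_pos[of i]
        by (intro mult_left_mono power_mono) (auto simp: infnorm_pos_le)
      finally show "\<bar>e j $ i\<bar> \<le> (\<tau> (j - 1))\<^sup>2"
        using \<mu>_pos[of i] by (simp add: e_def abs_div_pos[symmetric] divide_le_eq mult.commute)
    qed
    have "infnorm (\<delta> k) \<le> infnorm (M k 0 *v d 0) + (\<Sum>j = 1..k. infnorm ((M k j ** diag_mat \<mu>) *v e j))"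
      unfolding \<delta>_eq[OF less.prems] by (rule order_trans[OF infnorm_triangle add_left_mono[OF infnorm_sum]])
    also have "\<dots> \<le> mat_infnorm (M k 0) * diameter \<Theta>
        + (\<Sum>j = 1..k. (\<tau> (j - 1))\<^sup>2 * mat_infnorm (M k j ** diag_mat \<mu>))"
    proof (intro add_mono sum_mono)
      show "infnorm (M k 0 *v d 0) \<le> mat_infnorm (M k 0) * diameter \<Theta>"
        by (rule order_trans[OF infnorm_mult_le mult_left_mono[OF d0 mat_infnorm_nonneg]])
      show "infnorm ((M k j ** diag_mat \<mu>) *v e j) \<le> (\<tau> (j - 1))\<^sup>2 * mat_infnorm (M k j ** diag_mat \<mu>)"
        if "j \<in> {1..k}" for j
        using order_trans[OF infnorm_mult_le mult_left_mono[OF e[OF that] mat_infnorm_nonneg]]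
        by (simp only: mult.commute)
    qed
    also have "\<dots> \<le> \<tau> k"
      using error_bound[OF less.prems] by (simp add: M_def)
    finally have "infnorm (\<delta> k) \<le> \<tau> k" .
    \<comment> \<open>Tightening at work: the effect of the deviation \<open>\<delta> k\<close> on
      either steplength constraint is at most the margin reserved for it.\<close>
    moreover have "?a p \<bullet> vstack (\<zeta>hat k) (vec (\<alpha>hat k)) + ?a p \<bullet> \<delta> k + step_b c\<alpha> C\<alpha> p \<le> 0"
      if p: "p \<in> {1, 2}" for p
    proof -
      have dual: "?a p \<bullet> (X *v y) \<le> l1norm (?a p v* X) * b" if "infnorm y \<le> b"
        for X :: "real^('n + 'd)^(('n + 'd) + 1)" and y b
      proof -
        have "?a p \<bullet> (X *v y) \<le> l1norm (?a p v* X) * infnorm y"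
          using abs_inner_le_l1norm_infnorm[of "?a p v* X" y] by (simp add: dot_lmul_matrix)
        then show ?thesis
          using mult_left_mono[OF that l1norm_nonneg] by (meson order_trans)
      qed
      have "?a p \<bullet> \<delta> k = ?a p \<bullet> (M k 0 *v d 0) + (\<Sum>j = 1..k. ?a p \<bullet> ((M k j ** diag_mat \<mu>) *v e j))"
        unfolding \<delta>_eq[OF less.prems] by (simp add: inner_add_right inner_sum_right)
      also have "\<dots> \<le> l1norm (?a p v* M k 0) * diameter \<Theta>
          + (\<Sum>j = 1..k. (\<tau> (j - 1))\<^sup>2 * l1norm (?a p v* (M k j ** diag_mat \<mu>)))"
        by (intro add_mono sum_mono dual[OF d0] dual[OF e, unfolded mult.commute[of "l1norm _"]])
      finally show ?thesis
        using constraint_tightening[OF less.prems p] unfolding M_def by linarith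
    qed
    \<comment> \<open>Nominal steplength plus deviation is \<open>\<alpha> k\<close>;
      \<open>p = 1\<close> gives the upper bound and \<open>p = 2\<close> the lower one.\<close>
    from this[of 1] this[of 2] have "\<alpha> k \<in> {c\<alpha>..C\<alpha>}"
      by (simp add: step_a_inner step_b_def \<delta>_def u_def)
    ultimately show ?case by blast
  qed
  show "infnorm (vstack (\<zeta> n - \<zeta>hat n) (vec (\<alpha> n - \<alpha>hat n)) :: real^(('n + 'd) + 1)) \<le> \<tau> n"
    and "\<alpha> n \<in> {c\<alpha>..C\<alpha>}"
    using claim[OF n] by (simp_all add: \<delta>_def x_def u_def)
qed

end
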